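(* Let $(\mathfrak{g},[\cdot,\cdot],s,\alpha)$ be a finite-dimensional Hom-Lie superalgebra in characteristic $2$ and let $(\mathfrak{g}_t,[\cdot,\cdot]_t,s_t,\alpha)$ be a deformation of it, with $[\cdot,\cdot]_t=[\cdot,\cdot]+\sum_{i\ge1}c_it^i$ and $s_t=s+\sum_{i\ge1}\mathfrak{p}_it^i$. Assume that $(c_1,\mathfrak{p}_1)\ne(0,0)$. Then: (i) $(c_1,\mathfrak{p}_1)$ is a $2$-cocycle, i.e. $(c_1,\mathfrak{p}_1)\in Z^2_\alpha(\mathfrak{g};\mathfrak{g})$. (ii) For $n>1$, consider the maps $$C_n(x,y,z):=\sum_{\substack{i+j=n\\ i,j<n}}\big(c_i(c_j(x,y),\alpha(z))+c_i(c_j(y,z),\alpha(x))+c_i(c_j(z,x),\alpha(y))\big),\quad x,y,z\in\mathfrak{g},$$ $$Q_n(x,y):=\sum_{\substack{i+j=n\\ i,j<n}}c_i(\mathfrak{p}_j(x),\alpha(y))+\sum_{\substack{i+j=n\\ i,j<n}}c_i(c_j(x,y),\alpha(x)),\quad x\in\mathfrak{g}_{\bar 1},\ y\in\mathfrak{g}.$$ A deformation of order $n-1$ (given by $(c_i,\mathfrak{p}_i)$, $1\le i\le n-1$) can be extended to a deformation of order $n$ if and only if there exists $(c_n,\mathfrak{p}_n)\in XC^2_{\alpha,\bar 0}(\mathfrak{g};\mathfrak{g})$ such that $$(C_n,Q_n)=\mathfrak{d}^2_\alpha(c_n,\mathfrak{p}_n).$$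
   Context: All vector spaces are over a field $\mathbb{K}$ of characteristic $2$. Hom-Lie superalgebra in characteristic 2: a quadruple $(\mathfrak{g},[\cdot,\cdot],s,\alpha)$ with $\mathfrak{g}=\mathfrak{g}_{\bar 0}\oplus\mathfrak{g}_{\bar 1}$ a superspace, $[\cdot,\cdot]$ a symmetric bilinear bracket, $s:\mathfrak{g}_{\bar 1}\to\mathfrak{g}_{\bar 0}$ with $s(\lambda x)=\lambda^2s(x)$, $\alpha\in\mathrm{End}(\mathfrak{g})$ even, such that (i) on $\mathfrak{g}_{\bar 0}$: $[x,x]=0$, $\alpha([x,y])=[\alpha(x),\alpha(y)]$ and $[\alpha(x),[y,z]]+[\alpha(y),[z,x]]+[\alpha(z),[x,y]]=0$; (ii) $\mathfrak{g}_{\bar 1}$ is a $\mathfrak{g}_{\bar 0}$-module via the bracket (made two-sided by symmetry): $[\alpha(x),\alpha(v)]=\alpha([x,v])$ and $[[x,y],\alpha(v)]=[\alpha(x),[y,v]]+[\alpha(y),[x,v]]$ for $x,y\in\mathfrak{g}_{\bar 0}$, $v\in\mathfrak{g}_{\bar 1}$; (iii) $(x,y)\mapsto s(x+y)+s(x)+s(y)$ on $\mathfrak{g}_{\bar 1}\times\mathfrak{g}_{\bar 1}$ is bilinear and equals $[x,y]$; (iv) $[s(x),\alpha(y)]=[\alpha(x),[x,y]]$ for $x\in\mathfrak{g}_{\bar 1}$, $y\in\mathfrak{g}$; $\alpha([x,y])=[\alpha(x),\alpha(y)]$ for $x,y\in\mathfrak{g}$; $\alpha(s(x))=s(\alpha(x))$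 for $x\in\mathfrak{g}_{\bar 1}$. Cohomology with adjoint coefficients ($M=\mathfrak{g}$, $\beta=\alpha$, $x\cdot y=[x,y]$): $XC^2_\alpha(\mathfrak{g};\mathfrak{g})$ is the set of pairs $(c,\mathfrak{p})$ with $c:\wedge^2\mathfrak{g}\to\mathfrak{g}$ alternating bilinear, $\mathfrak{p}:\mathfrak{g}_{\bar 1}\to\mathfrak{g}$ with $\mathfrak{p}(\lambda x)=\lambda^2\mathfrak{p}(x)$, $\alpha(c(x,y))=c(\alpha(x),\alpha(y))$, $\alpha(\mathfrak{p}(x))=\mathfrak{p}(\alpha(x))$, and $\mathfrak{p}(x+y)+\mathfrak{p}(x)+\mathfrak{p}(y)=c(x,y)$ for $x,y\in\mathfrak{g}_{\bar 1}$. $XC^2_{\alpha,\bar 0}$ is the subspace of even cochains ($c$ even, $\mathfrak{p}(\mathfrak{g}_{\bar 1})\subseteq\mathfrak{g}_{\bar 0}$). The differential is $\mathfrak{d}^2_\alpha(c,\mathfrak{p})=(d^2_\alpha c,d^2_\alpha\mathfrak{p})$ with $$d^2_\alpha c(z_1,z_2,z_3)=[\alpha(z_1),c(z_2,z_3)]+c([z_1,z_2],\alpha(z_3))+\text{cyclic permutations of }(z_1,z_2,z_3),$$ $$d^2_\alpha\mathfrak{p}(x,z)=[\alpha(x),c(x,z)]+[\alpha(z),\mathfrak{p}(x)]+c(s(x),\alpha(z))+c([x,z],\alpha(x))\quad(x\in\mathfrak{g}_{\bar 1},\ z\in\mathfrak{g}),$$ and $Z^2_\alpha(\mathfrak{g};\mathfrak{g})=\ker\mathfrak{d}^2_\alpha$.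 Deformations: a deformation of $\mathfrak{g}$ is a Hom-Lie superalgebra structure $(\mathfrak{g}_t,[\cdot,\cdot]_t,s_t,\alpha)$ over $\mathbb{K}[[t]]$ on $\mathfrak{g}\otimes\mathbb{K}[[t]]$ ($\alpha$ extended $\mathbb{K}[[t]]$-linearly) with $\mathbb{K}[[t]]$-bilinear bracket given for $x,y\in\mathfrak{g}$ by $[x,y]_t=[x,y]+\sum_{i\ge1}c_i(x,y)t^i$ and squaring with respect to $\mathbb{K}[[t]]$ given for $x\in\mathfrak{g}_{\bar 1}$ by $s_t(x)=s(x)+\sum_{i\ge1}\mathfrak{p}_i(x)t^i$, where $(c_i,\mathfrak{p}_i)\in XC^2_{\alpha,\bar 0}(\mathfrak{g};\mathfrak{g})$ for all $i\ge1$; $s_t$ is extended to $\mathfrak{g}_{\bar 1}\otimes\mathbb{K}[[t]]$ using $s_t(\lambda u)=\lambda^2s_t(u)$ for $\lambda\in\mathbb{K}[[t]]$ and $s_t(u+v)=s_t(u)+s_t(v)+[u,v]_t$. Set $c_0=[\cdot,\cdot]$, $\mathfrak{p}_0=s$. A deformation of order $n$ is a choice of $(c_i,\mathfrak{p}_i)\in XC^2_{\alpha,\bar 0}(\mathfrak{g};\mathfrak{g})$, $1\le i\le n$, such that $[\cdot,\cdot]_t=[\cdot,\cdot]+\sum_{1\le i\le n}c_it^i$ and $s_t=s+\sum_{1\le i\le n}\mathfrak{p}_it^i$ define a Hom-Lie superalgebra structure modulo $t^{n+1}$. *)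

theory Defs
  imports Complex_Main "HOL-Computational_Algebra.Formal_Power_Series"
begin

section \<open>Hom-Lie superalgebras in characteristic 2\<close>

definition bilinear_map ::
  "('r::comm_ring_1 \<Rightarrow> 'g::ab_group_add \<Rightarrow> 'g) \<Rightarrow> ('g \<Rightarrow> 'g \<Rightarrow> 'g) \<Rightarrow> bool" where
  "bilinear_map scale c \<longleftrightarrow>
     (\<forall>x. module_hom scale scale (\<lambda>y. c x y)) \<and> (\<forall>y. module_hom scale scale (\<lambda>x. c x y))"

definition even_bilinear :: "'g set \<Rightarrow> 'g set \<Rightarrow> ('g \<Rightarrow> 'g \<Rightarrow> 'g) \<Rightarrow> bool" where
  "even_bilinear g0 g1 c \<longleftrightarrow>
     (\<forall>x\<in>g0. \<forall>y\<in>g0. c x y \<in> g0) \<and> (\<forall>x\<in>g0. \<forall>y\<in>g1. c x y \<in> g1) \<and>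
     (\<forall>x\<in>g1. \<forall>y\<in>g0. c x y \<in> g1) \<and> (\<forall>x\<in>g1. \<forall>y\<in>g1. c x y \<in> g0)"

text \<open>
  The ground ring is a commutative ring, so that the same notion serves over a field and over its
  ring of formal power series.  Maps defined on the odd part only (such as \<^term>\<open>s\<close>) are total
  functions about which nothing is said outside \<^term>\<open>g1\<close>.

  The underlying data are exact, whereas the defining identities are required up to the
  relation \<^term>\<open>eq\<close>.  With equality for \<^term>\<open>eq\<close> this is a Hom-Lie superalgebra; with congruence
  modulo a power of \<open>t\<close> it is a Hom-Lie superalgebra structure modulo that power.
\<close>

locale hom_lie_superalgebra_upto = module scale
  for scale :: "'r::comm_ring_1 \<Rightarrow> 'g::ab_group_add \<Rightarrow> 'g" (infixr \<open>*s\<close> 75) +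
  fixes eq :: "'g \<Rightarrow> 'g \<Rightarrow> bool" (infix \<open>\<approx>\<close> 50)
    and g0 g1 :: "'g set"
    and br :: "'g \<Rightarrow> 'g \<Rightarrow> 'g" (\<open>\<lbrakk>_, _\<rbrakk>\<close>)
    and s :: "'g \<Rightarrow> 'g"
    and \<alpha> :: "'g \<Rightarrow> 'g"
  assumes char_2: "CHAR('r) = 2"
    and superspace: "subspace g0" "subspace g1" "g0 \<inter> g1 = {0}"
      "\<And>z. \<exists>x\<in>g0. \<exists>y\<in>g1. z = x + y"
    and bracket_bilinear: "bilinear_map scale br"
    and bracket_symmetric: "\<And>x y. \<lbrakk>x, y\<rbrakk> = \<lbrakk>y, x\<rbrakk>"
    and bracket_even: "even_bilinear g0 g1 br"
    and squaring_even: "\<And>x. x \<in> g1 \<Longrightarrow> s x \<in> g0"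
    and squaring_scale: "\<And>a x. x \<in> g1 \<Longrightarrow> s (a *s x) = a\<^sup>2 *s s x"
    and twist_linear: "module_hom scale scale \<alpha>"
    and twist_even: "\<And>x. x \<in> g0 \<Longrightarrow> \<alpha> x \<in> g0" "\<And>x. x \<in> g1 \<Longrightarrow> \<alpha> x \<in> g1"
    \<comment> \<open>the even part is a Hom-Lie algebra\<close>
    and bracket_self: "\<And>x. x \<in> g0 \<Longrightarrow> \<lbrakk>x, x\<rbrakk> \<approx> 0"
    and twist_bracket_even: "\<And>x y. x \<in> g0 \<Longrightarrow> y \<in> g0 \<Longrightarrow> \<alpha> \<lbrakk>x, y\<rbrakk> \<approx> \<lbrakk>\<alpha> x, \<alpha> y\<rbrakk>"
    and hom_jacobi: "\<And>x y z. x \<in> g0 \<Longrightarrow> y \<in> g0 \<Longrightarrow> z \<in> g0 \<Longrightarrow>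
      \<lbrakk>\<alpha> x, \<lbrakk>y, z\<rbrakk>\<rbrakk> + \<lbrakk>\<alpha> y, \<lbrakk>z, x\<rbrakk>\<rbrakk> + \<lbrakk>\<alpha> z, \<lbrakk>x, y\<rbrakk>\<rbrakk> \<approx> 0"
    \<comment> \<open>the odd part is a module over the even part\<close>
    and twist_action: "\<And>x v. x \<in> g0 \<Longrightarrow> v \<in> g1 \<Longrightarrow> \<lbrakk>\<alpha> x, \<alpha> v\<rbrakk> \<approx> \<alpha> \<lbrakk>x, v\<rbrakk>"
    and hom_module: "\<And>x y v. x \<in> g0 \<Longrightarrow> y \<in> g0 \<Longrightarrow> v \<in> g1 \<Longrightarrow>
      \<lbrakk>\<lbrakk>x, y\<rbrakk>, \<alpha> v\<rbrakk> \<approx> \<lbrakk>\<alpha> x, \<lbrakk>y, v\<rbrakk>\<rbrakk> + \<lbrakk>\<alpha> y, \<lbrakk>x, v\<rbrakk>\<rbrakk>"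
    \<comment> \<open>polarisation of the squaring; its bilinearity is that of the bracket\<close>
    and squaring_polar: "\<And>x y. x \<in> g1 \<Longrightarrow> y \<in> g1 \<Longrightarrow> s (x + y) + s x + s y \<approx> \<lbrakk>x, y\<rbrakk>"
    and squaring_jacobi: "\<And>x y. x \<in> g1 \<Longrightarrow> \<lbrakk>s x, \<alpha> y\<rbrakk> \<approx> \<lbrakk>\<alpha> x, \<lbrakk>x, y\<rbrakk>\<rbrakk>"
    and twist_bracket: "\<And>x y. \<alpha> \<lbrakk>x, y\<rbrakk> \<approx> \<lbrakk>\<alpha> x, \<alpha> y\<rbrakk>"
    and twist_squaring: "\<And>x. x \<in> g1 \<Longrightarrow> \<alpha> (s x) \<approx> s (\<alpha> x)"

abbreviation hom_lie_superalgebra ::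
  "('r::comm_ring_1 \<Rightarrow> 'g::ab_group_add \<Rightarrow> 'g) \<Rightarrow> 'g set \<Rightarrow> 'g set \<Rightarrow>
     ('g \<Rightarrow> 'g \<Rightarrow> 'g) \<Rightarrow> ('g \<Rightarrow> 'g) \<Rightarrow> ('g \<Rightarrow> 'g) \<Rightarrow> bool" where
  "hom_lie_superalgebra scale g0 g1 br s \<alpha> \<equiv>
     hom_lie_superalgebra_upto scale (=) g0 g1 br s \<alpha>"

definition finite_dimensional ::
  "('k::field \<Rightarrow> 'g::ab_group_add \<Rightarrow> 'g) \<Rightarrow> bool" where
  "finite_dimensional scale \<longleftrightarrow> (\<exists>B. finite_dimensional_vector_space scale B)"


section \<open>Cochains and cocycles of degree 2 with adjoint coefficients\<close>

definition XC2 ::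
  "('k::field \<Rightarrow> 'g::ab_group_add \<Rightarrow> 'g) \<Rightarrow> 'g set \<Rightarrow> ('g \<Rightarrow> 'g) \<Rightarrow>
     (('g \<Rightarrow> 'g \<Rightarrow> 'g) \<times> ('g \<Rightarrow> 'g)) set" where
  "XC2 scale g1 \<alpha> = {(c, p).
     bilinear_map scale c \<and> (\<forall>x. c x x = 0) \<and>
     (\<forall>a. \<forall>x\<in>g1. p (scale a x) = scale (a\<^sup>2) (p x)) \<and>
     (\<forall>x y. \<alpha> (c x y) = c (\<alpha> x) (\<alpha> y)) \<and>
     (\<forall>x\<in>g1. \<alpha> (p x) = p (\<alpha> x)) \<and>
     (\<forall>x\<in>g1. \<forall>y\<in>g1. p (x + y) + p x + p y = c x y)}"

definition XC2_even ::
  "('k::field \<Rightarrow> 'g::ab_group_add \<Rightarrow> 'g) \<Rightarrow> 'g set \<Rightarrow> 'g set \<Rightarrow> ('g \<Rightarrow> 'g) \<Rightarrow>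
     (('g \<Rightarrow> 'g \<Rightarrow> 'g) \<times> ('g \<Rightarrow> 'g)) set" where
  "XC2_even scale g0 g1 \<alpha> =
     {(c, p) \<in> XC2 scale g1 \<alpha>. even_bilinear g0 g1 c \<and> (\<forall>x\<in>g1. p x \<in> g0)}"

definition d2_c ::
  "('g::ab_group_add \<Rightarrow> 'g \<Rightarrow> 'g) \<Rightarrow> ('g \<Rightarrow> 'g) \<Rightarrow> ('g \<Rightarrow> 'g \<Rightarrow> 'g) \<Rightarrow>
     'g \<Rightarrow> 'g \<Rightarrow> 'g \<Rightarrow> 'g" where
  "d2_c br \<alpha> c z1 z2 z3 =
     (br (\<alpha> z1) (c z2 z3) + c (br z1 z2) (\<alpha> z3)) +
     (br (\<alpha> z2) (c z3 z1) + c (br z2 z3) (\<alpha> z1)) +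
     (br (\<alpha> z3) (c z1 z2) + c (br z3 z1) (\<alpha> z2))"

definition d2_p ::
  "('g::ab_group_add \<Rightarrow> 'g \<Rightarrow> 'g) \<Rightarrow> ('g \<Rightarrow> 'g) \<Rightarrow> ('g \<Rightarrow> 'g) \<Rightarrow> ('g \<Rightarrow> 'g \<Rightarrow> 'g) \<Rightarrow>
     ('g \<Rightarrow> 'g) \<Rightarrow> 'g \<Rightarrow> 'g \<Rightarrow> 'g" where
  "d2_p br s \<alpha> c p x z =
     br (\<alpha> x) (c x z) + br (\<alpha> z) (p x) + c (s x) (\<alpha> z) + c (br x z) (\<alpha> x)"

definition Z2 ::
  "('k::field \<Rightarrow> 'g::ab_group_add \<Rightarrow> 'g) \<Rightarrow> 'g set \<Rightarrow> ('g \<Rightarrow> 'g \<Rightarrow> 'g) \<Rightarrow> ('g \<Rightarrow> 'g) \<Rightarrow>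
     ('g \<Rightarrow> 'g) \<Rightarrow> (('g \<Rightarrow> 'g \<Rightarrow> 'g) \<times> ('g \<Rightarrow> 'g)) set" where
  "Z2 scale g1 br s \<alpha> =
     {(c, p) \<in> XC2 scale g1 \<alpha>.
        (\<forall>x y z. d2_c br \<alpha> c x y z = 0) \<and> (\<forall>x\<in>g1. \<forall>z. d2_p br s \<alpha> c p x z = 0)}"


section \<open>Extension of scalars to formal power series\<close>

text \<open>
  For a finite-dimensional space \<open>V\<close>, the extension of scalars of \<open>V\<close> to \<open>K[[t]]\<close> is the module
  of formal power series with coefficients in \<open>V\<close>; an element \<open>x\<close> of \<open>V\<close> is identified with
  the constant series \<^term>\<open>fps_const x\<close>.  The lemmas \<open>span_const_series\<close> and
  \<open>independent_const_series\<close> below justify this: a basis of \<open>V\<close> becomes a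
  \<open>K[[t]]\<close>-basis.  Likewise \<^term>\<open>series_in W\<close> is the extension of scalars of a subspace \<open>W\<close>.
\<close>

definition fps_scale ::
  "('k::field \<Rightarrow> 'g::ab_group_add \<Rightarrow> 'g) \<Rightarrow> 'k fps \<Rightarrow> 'g fps \<Rightarrow> 'g fps" where
  "fps_scale scale a u = Abs_fps (\<lambda>n. \<Sum>i\<le>n. scale (fps_nth a i) (fps_nth u (n - i)))"

definition series_in :: "'g::zero set \<Rightarrow> 'g fps set" where
  "series_in W = {u. \<forall>n. fps_nth u n \<in> W}"

definition fps_map :: "('g \<Rightarrow> 'g) \<Rightarrow> 'g::zero fps \<Rightarrow> 'g fps" where
  "fps_map f u = Abs_fps (\<lambda>n. f (fps_nth u n))"

text \<open>Congruence modulo \<open>t^(n+1)\<close>.\<close>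

definition eq_mod_t :: "nat \<Rightarrow> 'g::zero fps \<Rightarrow> 'g fps \<Rightarrow> bool" where
  "eq_mod_t n u v \<longleftrightarrow> (\<forall>k\<le>n. fps_nth u k = fps_nth v k)"

lemma module_fps_scale:
  assumes "vector_space scale"
  shows "module (fps_scale scale)"
proof -
  interpret vector_space scale by fact
  show ?thesis
  proof
    fix a b :: "'a fps" and x y :: "'b fps"
    show "fps_scale scale a (x + y) = fps_scale scale a x + fps_scale scale a y"
      by (simp add: fps_scale_def fps_eq_iff scale_right_distrib sum.distrib)
    show "fps_scale scale (a + b) x = fps_scale scale a x + fps_scale scale b x"
      by (simp add: fps_scale_def fps_eq_iff scale_left_distrib sum.distrib)
    show "fps_scale scale 1 x = x"
    proof (rule fps_ext)
      fix n
      have "(\<Sum>i\<le>n. scale (fps_nth 1 i) (fps_nth x (n - i))) =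
            (\<Sum>i\<in>{..n}. if i = 0 then fps_nth x n else 0)"
        by (rule sum.cong) auto
      then show "fps_nth (fps_scale scale 1 x) n = fps_nth x n"
        by (simp add: fps_scale_def)
    qed
    show "fps_scale scale a (fps_scale scale b x) = fps_scale scale (a * b) x"
    proof (rule fps_ext)
      fix n
      let ?f = "\<lambda>j k. scale (fps_nth a j * fps_nth b k) (fps_nth x (n - (j + k)))"
      have "(\<Sum>i\<le>n. \<Sum>j\<le>i. ?f j (i - j)) = (\<Sum>j\<le>n. \<Sum>k\<le>n - j. ?f j k)"
        by (simp add: sum.triangle_reindex_eq[symmetric] sum.Sigma)
          (rule sum.reindex_bij_witness[of _ "\<lambda>(j, k). (j + k, j)" "\<lambda>(i, j). (j, i - j)"]; auto)
      then show "fps_nth (fps_scale scale a (fps_scale scale b x)) n =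
          fps_nth (fps_scale scale (a * b) x) n"
        by (simp add: fps_scale_def fps_mult_nth scale_sum_right scale_sum_left
            atLeast0AtMost diff_diff_left)
    qed
  qed
qed

lemma fps_scale_const:
  assumes "vector_space scale"
  shows "fps_scale scale a (fps_const x) = Abs_fps (\<lambda>n. scale (fps_nth a n) x)"
proof -
  interpret vector_space scale by fact
  have "(\<Sum>i\<le>n. scale (fps_nth a i) (if n - i = 0 then x else 0)) = scale (fps_nth a n) x" for n
  proof -
    have "(\<Sum>i\<le>n. scale (fps_nth a i) (if n - i = 0 then x else 0)) =
          (\<Sum>i\<in>{..n}. if i = n then scale (fps_nth a i) x else 0)"
      by (rule sum.cong) auto
    then show ?thesis by simp
  qed
  then show ?thesis
    by (simp add: fps_scale_def)
qed

lemma subspace_series_in: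
  assumes "vector_space scale" "module.subspace scale W"
  shows "module.subspace (fps_scale scale) (series_in W)"
proof -
  interpret vector_space scale by fact
  interpret F: module "fps_scale scale" using assms(1) by (rule module_fps_scale)
  show ?thesis using assms(2)
    by (auto simp: F.subspace_def series_in_def fps_scale_def subspace_0
        intro!: subspace_add subspace_sum subspace_scale)
qed

lemma span_const_series:
  assumes "finite B" "vector_space scale"
  shows "module.span (fps_scale scale) (fps_const ` B) = series_in (module.span scale B)"
proof -
  interpret vector_space scale by fact
  interpret F: module "fps_scale scale" using assms(2) by (rule module_fps_scale)
  show ?thesis
  proof
    show "F.span (fps_const ` B) \<subseteq> series_in (span B)"
    proof (rule F.span_minimal)
      show "fps_const ` B \<subseteq> series_in (span B)"
        by (auto simp: series_in_def span_base span_zero)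
      show "F.subspace (series_in (span B))"
        by (intro subspace_series_in assms(2) subspace_span)
    qed
    show "series_in (span B) \<subseteq> F.span (fps_const ` B)"
    proof
      fix u assume "u \<in> series_in (span B)"
      then have "\<forall>n. \<exists>r. fps_nth u n = (\<Sum>b\<in>B. scale (r b) b)"
        unfolding series_in_def span_finite[OF assms(1)] by blast
      then obtain r where r: "\<And>n. fps_nth u n = (\<Sum>b\<in>B. scale (r n b) b)" by metis
      have "u = (\<Sum>b\<in>B. fps_scale scale (Abs_fps (\<lambda>n. r n b)) (fps_const b))"
        by (simp add: fps_eq_iff fps_sum_nth fps_scale_const[OF assms(2)] r)
      also have "\<dots> \<in> F.span (fps_const ` B)"
        by (intro F.span_sum F.span_scale F.span_base imageI)
      finally show "u \<in> F.span (fps_const ` B)" .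
    qed
  qed
qed

lemma independent_const_series:
  assumes "finite B" "vector_space scale" "\<not> module.dependent scale B"
  shows "\<not> module.dependent (fps_scale scale) (fps_const ` B)"
proof -
  interpret vector_space scale by fact
  interpret F: module "fps_scale scale" using assms(2) by (rule module_fps_scale)
  have inj: "inj_on fps_const B"
    by (rule inj_onI) (metis fps_nth_fps_const)
  show ?thesis
    unfolding F.dependent_finite[OF finite_imageI[OF assms(1)]]
  proof safe
    fix f b
    assume f: "(\<Sum>v\<in>fps_const ` B. fps_scale scale (f v) v) = 0"
      and b: "b \<in> B" and nz: "f (fps_const b) \<noteq> 0"
    have "(\<Sum>b\<in>B. scale (fps_nth (f (fps_const b)) n) b) = 0" for n
    proof -
      have "fps_nth (\<Sum>b\<in>B. fps_scale scale (f (fps_const b)) (fps_const b)) n = 0"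
        using f by (simp add: sum.reindex[OF inj])
      then show ?thesis by (simp add: fps_sum_nth fps_scale_const[OF assms(2)])
    qed
    then have "fps_nth (f (fps_const b)) n = 0" for n
      using independentD[OF assms(3) assms(1) subset_refl, of "\<lambda>b. fps_nth (f (fps_const b)) n"]
        b by blast
    then show False using nz by (auto simp: fps_eq_iff)
  qed
qed

lemma fps_map_extends_scalars:
  assumes "vector_space scale" "module_hom scale scale f"
  shows "module_hom (fps_scale scale) (fps_scale scale) (fps_map f)"
    and "fps_map f (fps_const x) = fps_const (f x)"
proof -
  interpret f: module_hom scale scale f by fact
  interpret F: module "fps_scale scale" using assms(1) by (rule module_fps_scale)
  show "module_hom (fps_scale scale) (fps_scale scale) (fps_map f)"
    by unfold_locales
      (auto simp: fps_map_def fps_scale_def fps_eq_iff f.add f.sum f.scale)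
  show "fps_map f (fps_const x) = fps_const (f x)"
    by (auto simp: fps_map_def fps_eq_iff f.zero)
qed


section \<open>Deformations\<close>

text \<open>
  \<^term>\<open>B\<close> and \<^term>\<open>S\<close> are the extensions to \<open>K[[t]]\<close> of the bracket \<open>\<Sum>i. c i t^i\<close>
  and of the squaring \<open>\<Sum>i. p i t^i\<close>.  By \<open>span_const_series\<close> these rules determine
  \<^term>\<open>B\<close>, and \<^term>\<open>S\<close> on the odd part, in the finite-dimensional case.
\<close>

definition formal_extension ::
  "('k::field \<Rightarrow> 'g::ab_group_add \<Rightarrow> 'g) \<Rightarrow> 'g set \<Rightarrow>
     (nat \<Rightarrow> 'g \<Rightarrow> 'g \<Rightarrow> 'g) \<Rightarrow> (nat \<Rightarrow> 'g \<Rightarrow> 'g) \<Rightarrow>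
     ('g fps \<Rightarrow> 'g fps \<Rightarrow> 'g fps) \<Rightarrow> ('g fps \<Rightarrow> 'g fps) \<Rightarrow> bool" where
  "formal_extension scale g1 c p B S \<longleftrightarrow>
     bilinear_map (fps_scale scale) B \<and>
     (\<forall>x y. B (fps_const x) (fps_const y) = Abs_fps (\<lambda>i. c i x y)) \<and>
     (\<forall>x\<in>g1. S (fps_const x) = Abs_fps (\<lambda>i. p i x)) \<and>
     (\<forall>a. \<forall>u\<in>series_in g1. S (fps_scale scale a u) = fps_scale scale (a\<^sup>2) (S u)) \<and>
     (\<forall>u\<in>series_in g1. \<forall>v\<in>series_in g1. S (u + v) = S u + S v + B u v)"

definition deformation ::
  "('k::field \<Rightarrow> 'g::ab_group_add \<Rightarrow> 'g) \<Rightarrow> 'g set \<Rightarrow> 'g set \<Rightarrow>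
     ('g \<Rightarrow> 'g \<Rightarrow> 'g) \<Rightarrow> ('g \<Rightarrow> 'g) \<Rightarrow> ('g \<Rightarrow> 'g) \<Rightarrow>
     (nat \<Rightarrow> 'g \<Rightarrow> 'g \<Rightarrow> 'g) \<Rightarrow> (nat \<Rightarrow> 'g \<Rightarrow> 'g) \<Rightarrow>
     ('g fps \<Rightarrow> 'g fps \<Rightarrow> 'g fps) \<Rightarrow> ('g fps \<Rightarrow> 'g fps) \<Rightarrow> bool" where
  "deformation scale g0 g1 br s \<alpha> c p B S \<longleftrightarrow>
     c 0 = br \<and> (\<forall>x\<in>g1. p 0 x = s x) \<and>
     (\<forall>i\<ge>1. (c i, p i) \<in> XC2_even scale g0 g1 \<alpha>) \<and>
     formal_extension scale g1 c p B S \<and>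
     hom_lie_superalgebra (fps_scale scale) (series_in g0) (series_in g1) B S (fps_map \<alpha>)"

text \<open>Only the values of \<^term>\<open>c\<close> and \<^term>\<open>p\<close> at indices up to \<^term>\<open>n\<close> matter here.\<close>

definition deformation_of_order ::
  "nat \<Rightarrow> ('k::field \<Rightarrow> 'g::ab_group_add \<Rightarrow> 'g) \<Rightarrow> 'g set \<Rightarrow> 'g set \<Rightarrow>
     ('g \<Rightarrow> 'g \<Rightarrow> 'g) \<Rightarrow> ('g \<Rightarrow> 'g) \<Rightarrow> ('g \<Rightarrow> 'g) \<Rightarrow>
     (nat \<Rightarrow> 'g \<Rightarrow> 'g \<Rightarrow> 'g) \<Rightarrow> (nat \<Rightarrow> 'g \<Rightarrow> 'g) \<Rightarrow> bool" where
  "deformation_of_order n scale g0 g1 br s \<alpha> c p \<longleftrightarrow>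
     c 0 = br \<and> (\<forall>x\<in>g1. p 0 x = s x) \<and>
     (\<forall>i\<in>{1..n}. (c i, p i) \<in> XC2_even scale g0 g1 \<alpha>) \<and>
     (\<exists>B S.
        formal_extension scale g1
          (\<lambda>i x y. if i \<le> n then c i x y else 0) (\<lambda>i x. if i \<le> n then p i x else 0) B S \<and>
        hom_lie_superalgebra_upto (fps_scale scale) (eq_mod_t n)
          (series_in g0) (series_in g1) B S (fps_map \<alpha>))"

definition obstruction_C ::
  "('g::ab_group_add \<Rightarrow> 'g) \<Rightarrow> (nat \<Rightarrow> 'g \<Rightarrow> 'g \<Rightarrow> 'g) \<Rightarrow> nat \<Rightarrow> 'g \<Rightarrow> 'g \<Rightarrow> 'g \<Rightarrow> 'g" where
  "obstruction_C \<alpha> c n x y z =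
     (\<Sum>(i, j)\<in>{(i, j). i + j = n \<and> i < n \<and> j < n}.
        c i (c j x y) (\<alpha> z) + c i (c j y z) (\<alpha> x) + c i (c j z x) (\<alpha> y))"

definition obstruction_Q ::
  "('g::ab_group_add \<Rightarrow> 'g) \<Rightarrow> (nat \<Rightarrow> 'g \<Rightarrow> 'g \<Rightarrow> 'g) \<Rightarrow> (nat \<Rightarrow> 'g \<Rightarrow> 'g) \<Rightarrow> nat \<Rightarrow>
     'g \<Rightarrow> 'g \<Rightarrow> 'g" where
  "obstruction_Q \<alpha> c p n x y =
     (\<Sum>(i, j)\<in>{(i, j). i + j = n \<and> i < n \<and> j < n}. c i (p j x) (\<alpha> y)) +
     (\<Sum>(i, j)\<in>{(i, j). i + j = n \<and> i < n \<and> j < n}. c i (c j x y) (\<alpha> x))"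

end

theory Submission
  imports Defs
begin

text \<open>
  Everything rests on one equivalence, \<open>deformation_of_order_iff\<close>: cochains
  \<open>(c i, p i)\<close>, \<open>i \<le> n\<close>, form a deformation of order \<open>n\<close> exactly when, for every \<open>m \<le> n\<close>,
  the coefficients of \<open>t^m\<close> in two expressions vanish on \<^emph>\<open>constant\<close> arguments: the Jacobiator
  \<open>[[x, y], \<alpha> z] + cyclic\<close> and, for odd \<open>x\<close>, the squaring defect
  \<open>[s x, \<alpha> y] + [[x, y], \<alpha> x]\<close>.  These coefficients are convolutions
  \<open>\<Sum>i. c i (c (m - i) x y) (\<alpha> z) + \<dots>\<close>.  For \<open>m = n\<close> the two end terms, which contain
  \<open>c n\<close> and \<open>p n\<close> once and the bracket or the squaring once, add up to the coboundary
  \<open>d\<^sup>2 (c n, p n)\<close>, and all other terms to the obstruction \<open>(C n, Q n)\<close>.  As \<open>-1 = 1\<close>, a sum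
  vanishes exactly when its two parts agree, which is the extension criterion.  For \<open>n = 1\<close> the
  obstruction is an empty sum, whence the cocycle condition.

  In the equivalence, necessity needs the Jacobiator to vanish on all triples, whereas the Hom-Jacobi
  identity and the module axiom give it only when two arguments are even.  Among three homogeneous elements two have the same
  parity, and polarising the squaring axiom covers the case of two odd arguments
  (\<open>coeffs_vanish\<close>).  Sufficiency has two parts.  The bracket and the squaring
  must exist as maps on power series: each cochain is extended by convolution, the extension of
  \<open>p i\<close> being the quadratic refinement of that of \<open>c i\<close> (\<open>formal_extension_exists\<close>).
  And the two identities must pass from constants to all series: modulo \<open>t^(n+1)\<close> a
  series is a finite sum of terms \<open>t^k x\<close>, the Jacobiator is trilinear, and the squaring defect is
  quadratic with polarisation the Jacobiator (\<open>J_vanishes\<close>, \<open>D_vanishes\<close>).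
\<close>

unbundle fps_syntax

section \<open>Power series over a space of characteristic 2\<close>

lemma bilinear_mapD:
  assumes "bilinear_map sc c"
  shows "c (x + x') y = c x y + c x' y" and "c x (y + y') = c x y + c x y'"
    and "c (sc a x) y = sc a (c x y)" and "c x (sc a y) = sc a (c x y)"
    and "c 0 y = 0" and "c x 0 = 0"
proof -
  interpret l: module_hom sc sc "\<lambda>x. c x y" for y
    using assms by (simp add: bilinear_map_def)
  interpret r: module_hom sc sc "c x" for x
    using assms by (simp add: bilinear_map_def)
  show "c (x + x') y = c x y + c x' y" "c x (y + y') = c x y + c x y'"
    "c (sc a x) y = sc a (c x y)" "c x (sc a y) = sc a (c x y)" "c 0 y = 0" "c x 0 = 0"
    by (simp_all add: l.add r.add l.scale r.scale)
qed

lemma bilinear_mapI: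
  assumes "module sc"
    and "\<And>x x' y. c (x + x') y = c x y + c x' y" and "\<And>x y y'. c x (y + y') = c x y + c x y'"
    and "\<And>a x y. c (sc a x) y = sc a (c x y)" and "\<And>a x y. c x (sc a y) = sc a (c x y)"
  shows "bilinear_map sc c"
proof -
  interpret module sc by fact
  show ?thesis unfolding bilinear_map_def
    by (auto intro!: module_hom.intro module_hom_axioms.intro assms)
qed

locale char_2_space = vector_space scale
  for scale :: "'k::field \<Rightarrow> 'g::ab_group_add \<Rightarrow> 'g" (infixr \<open>*s\<close> 74) +
  assumes char_2: "CHAR('k) = 2"
begin

abbreviation series_scale :: "'k fps \<Rightarrow> 'g fps \<Rightarrow> 'g fps" (infixr \<open>*t\<close> 74)
  where "series_scale \<equiv> fps_scale scale"

sublocale series: module series_scale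
  using vector_space_axioms by (rule module_fps_scale)

lemma add_self: "(x::'g) + x = 0"
proof -
  have "x + x = of_nat (CHAR('k)) *s x"
    by (metis char_2 numeral_2_eq_2 of_nat_numeral one_add_one scale_left_distrib scale_one)
  then show ?thesis by simp
qed

lemma add_self_left: "(x::'g) + (x + y) = y"
  by (simp add: add_self flip: add.assoc)

lemma eq_iff_add_eq_0: "(x::'g) = y \<longleftrightarrow> x + y = 0"
  by (metis add_self add_self_left add_0_right)

lemma series_add_self: "(u::'g fps) + u = 0"
  by (simp add: fps_eq_iff add_self)

lemma series_add_self_left: "(u::'g fps) + (u + v) = v"
  by (simp add: series_add_self flip: add.assoc)

text \<open>
  Together with the cancellation laws, the laws of a commutative monoid decide every linear
  identity in characteristic 2: sorting the summands makes equal ones adjacent.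
\<close>
lemmas char_2_simps = ac_simps add_self add_self_left series_add_self series_add_self_left

lemma nth_X_power_scale: "(fps_X ^ k *t u) $ m = (if m < k then 0 else u $ (m - k))"
proof -
  have "(\<Sum>i\<le>m. (if i = k then 1 else 0) *s (u $ (m - i))) =
    (\<Sum>i\<in>{..m}. if i = k then u $ (m - i) else 0)"
    by (rule sum.cong) auto
  then show ?thesis by (simp add: fps_scale_def)
qed

lemma nth_X_scale: "(fps_X *t u) $ m = (if m = 0 then 0 else u $ (m - 1))"
  using nth_X_power_scale[of 1 u m] by simp

lemma nth_const_scale: "(fps_const a *t u) $ m = a *s (u $ m)"
proof -
  have "(\<Sum>i\<le>m. (fps_const a $ i) *s (u $ (m - i))) =
    (\<Sum>i\<in>{..m}. if i = 0 then a *s (u $ (m - i)) else 0)"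
    by (rule sum.cong) auto
  then show ?thesis by (simp add: fps_scale_def)
qed

lemma series_split: "(u::'g fps) = fps_const (u $ 0) + fps_X *t fps_shift 1 u"
  by (simp add: fps_eq_iff nth_X_scale)

lemma scalar_split: "(a::'k fps) = fps_const (a $ 0) + fps_X * fps_shift 1 a"
  by (simp add: fps_eq_iff)

text \<open>
  The step from constants to all series.  Splitting off constant terms writes \<open>u\<close> as a finite sum
  of terms \<open>t^k x\<close> and a multiple of \<open>t^N\<close>, so a property that is additive need only be checked
  on these two kinds of series.
\<close>
lemma series_induct [consumes 1, case_names const add high]:
  assumes "u \<in> series_in W"
    and const: "\<And>k x. x \<in> W \<Longrightarrow> P (fps_X ^ k *t fps_const x)"
    and add: "\<And>u v. u \<in> series_in W \<Longrightarrow> v \<in> series_in W \<Longrightarrow> P u \<Longrightarrow> P v \<Longrightarrow> P (u + v)"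
    and high: "\<And>w. w \<in> series_in W \<Longrightarrow> P (fps_X ^ N *t w)"
    and W: "0 \<in> W"
  shows "P u"
proof -
  have mem: "fps_X ^ k *t w \<in> series_in W" if "w \<in> series_in W" for k w
    using that W by (auto simp: series_in_def nth_X_power_scale)
  \<comment> \<open>downward induction on the exponent, starting from the multiples of \<open>t^N\<close>\<close>
  have "P (fps_X ^ (N - k) *t u)" if "u \<in> series_in W" "k \<le> N" for k u
    using that
  proof (induction k arbitrary: u)
    case 0
    then show ?case using high by simp
  next
    case (Suc k)
    have X: "fps_X ^ (N - Suc k) * fps_X = (fps_X ^ (N - k) :: 'k fps)"
      using Suc.prems by (metis Suc_diff_Suc Suc_le_eq power_Suc2)
    have sh: "fps_shift 1 u \<in> series_in W" and c: "u $ 0 \<in> W"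
      using Suc.prems by (auto simp: series_in_def)
    then have c': "fps_const (u $ 0) \<in> series_in W" using W by (auto simp: series_in_def)
    have "fps_X ^ (N - Suc k) *t u =
      fps_X ^ (N - Suc k) *t fps_const (u $ 0) + fps_X ^ (N - k) *t fps_shift 1 u"
      by (subst series_split) (simp only: series.scale_right_distrib series.scale_scale X)
    then show ?case
      using add[OF mem[OF c'] mem[OF sh] const[OF c] Suc.IH[OF sh]] Suc.prems by simp
  qed
  from this[of u N] assms(1) show ?thesis by simp
qed

definition vanishes :: "nat \<Rightarrow> 'g fps \<Rightarrow> bool" where
  "vanishes n u \<longleftrightarrow> (\<forall>k\<le>n. u $ k = 0)"

lemma vanishes_add: "vanishes n u \<Longrightarrow> vanishes n v \<Longrightarrow> vanishes n (u + v)"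
  by (simp add: vanishes_def)

lemma vanishes_X_power: "vanishes n u \<Longrightarrow> vanishes n (fps_X ^ k *t u)"
  by (simp add: vanishes_def nth_X_power_scale)

lemma vanishes_high: "n < k \<Longrightarrow> vanishes n (fps_X ^ k *t u)"
  by (simp add: vanishes_def nth_X_power_scale)

lemma eq_mod_t_iff_vanishes: "eq_mod_t n u v \<longleftrightarrow> vanishes n (u + v)"
  using eq_iff_add_eq_0 by (simp add: eq_mod_t_def vanishes_def)

text \<open>
  A linear map over power series preserves divisibility by \<open>t^(n+1)\<close>, so it is determined modulo
  \<open>t^(n+1)\<close> by its values on constants.
\<close>
lemma vanishes_of_const:
  assumes add: "\<And>u v. F (u + v) = F u + F v" and scale: "\<And>a u. F (a *t u) = a *t F u"
    and const: "\<And>x. vanishes n (F (fps_const x))"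
  shows "vanishes n (F u)"
proof -
  have "u \<in> series_in UNIV" by (simp add: series_in_def)
  then show ?thesis
  proof (induction rule: series_induct[where N = "Suc n"])
    case (high w)
    show ?case by (simp add: scale vanishes_high del: power_Suc)
  qed (simp_all add: add scale const vanishes_add vanishes_X_power)
qed

end

section \<open>The Jacobiator and the squaring defect\<close>

text \<open>
  In characteristic 2 the condition \<open>[s x, \<alpha> y] = [\<alpha> x, [x, y]]\<close> on the squaring says that
  \<open>squaring_defect\<close> is zero, and the Hom-Jacobi identity together with the module axiom says
  that \<open>jacobiator\<close> vanishes when two arguments are even.
\<close>
definition jacobiator :: "('a::plus \<Rightarrow> 'a \<Rightarrow> 'a) \<Rightarrow> ('a \<Rightarrow> 'a) \<Rightarrow> 'a \<Rightarrow> 'a \<Rightarrow> 'a \<Rightarrow> 'a" where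
  "jacobiator B a x y z = B (B x y) (a z) + B (B y z) (a x) + B (B z x) (a y)"

definition squaring_defect ::
  "('a::plus \<Rightarrow> 'a \<Rightarrow> 'a) \<Rightarrow> ('a \<Rightarrow> 'a) \<Rightarrow> ('a \<Rightarrow> 'a) \<Rightarrow> 'a \<Rightarrow> 'a \<Rightarrow> 'a" where
  "squaring_defect B S a x y = B (S x) (a y) + B (B x y) (a x)"

text \<open>
  The coefficients of \<open>t^m\<close> in the Jacobiator and in the squaring defect at constant series; see
  \<open>nth_J_const\<close> and \<open>nth_D_const\<close>.
\<close>
definition jacobi_coeff ::
  "('g::ab_group_add \<Rightarrow> 'g) \<Rightarrow> (nat \<Rightarrow> 'g \<Rightarrow> 'g \<Rightarrow> 'g) \<Rightarrow> nat \<Rightarrow> 'g \<Rightarrow> 'g \<Rightarrow> 'g \<Rightarrow> 'g" where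
  "jacobi_coeff \<alpha> c m x y z = (\<Sum>i\<le>m. c i (c (m - i) x y) (\<alpha> z) +
     c i (c (m - i) y z) (\<alpha> x) + c i (c (m - i) z x) (\<alpha> y))"

definition squaring_coeff ::
  "('g::ab_group_add \<Rightarrow> 'g) \<Rightarrow> (nat \<Rightarrow> 'g \<Rightarrow> 'g \<Rightarrow> 'g) \<Rightarrow> (nat \<Rightarrow> 'g \<Rightarrow> 'g) \<Rightarrow> nat \<Rightarrow>
     'g \<Rightarrow> 'g \<Rightarrow> 'g" where
  "squaring_coeff \<alpha> c p m x y =
     (\<Sum>i\<le>m. c i (p (m - i) x) (\<alpha> y) + c i (c (m - i) x y) (\<alpha> x))"

lemma jacobi_coeff_cong:
  assumes "\<And>i. i \<le> m \<Longrightarrow> c i = c' i"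
  shows "jacobi_coeff \<alpha> c m = jacobi_coeff \<alpha> c' m"
  unfolding jacobi_coeff_def by (intro ext sum.cong refl) (simp add: assms)

lemma squaring_coeff_cong:
  assumes "\<And>i. i \<le> m \<Longrightarrow> c i = c' i" and "\<And>i. i \<le> m \<Longrightarrow> p i = p' i"
  shows "squaring_coeff \<alpha> c p m = squaring_coeff \<alpha> c' p' m"
  unfolding squaring_coeff_def by (intro ext sum.cong refl) (simp add: assms)

text \<open>
  The setting shared by both directions of the equivalence: given coefficient maps extended to
  series, before any Hom-Lie identity is known for the extension.
\<close>
locale formal_superalgebra = char_2_space scale
  for scale :: "'k::field \<Rightarrow> 'g::ab_group_add \<Rightarrow> 'g" (infixr \<open>*s\<close> 74) +
  fixes g1 :: "'g set" and c :: "nat \<Rightarrow> 'g \<Rightarrow> 'g \<Rightarrow> 'g" and p :: "nat \<Rightarrow> 'g \<Rightarrow> 'g"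
    and B :: "'g fps \<Rightarrow> 'g fps \<Rightarrow> 'g fps" and S :: "'g fps \<Rightarrow> 'g fps" and \<alpha> :: "'g \<Rightarrow> 'g"
  assumes extension: "formal_extension scale g1 c p B S"
    and symmetric: "B u v = B v u"
    and twist: "module_hom scale scale \<alpha>"
begin

abbreviation J where "J \<equiv> jacobiator B (fps_map \<alpha>)"
abbreviation D where "D \<equiv> squaring_defect B S (fps_map \<alpha>)"

lemma bilinear: "bilinear_map series_scale B"
  using extension by (simp add: formal_extension_def)

lemmas B_simps = bilinear_mapD[OF bilinear]

lemma B_split: "B u v = B (fps_const (u $ 0)) v + fps_X *t B (fps_shift 1 u) v"
  by (subst series_split[of u]) (simp add: B_simps)

lemma B_const: "B (fps_const x) (fps_const y) = Abs_fps (\<lambda>i. c i x y)"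
  and S_const: "x \<in> g1 \<Longrightarrow> S (fps_const x) = Abs_fps (\<lambda>i. p i x)"
  and S_scale: "u \<in> series_in g1 \<Longrightarrow> S (a *t u) = a\<^sup>2 *t S u"
  and S_add: "u \<in> series_in g1 \<Longrightarrow> v \<in> series_in g1 \<Longrightarrow> S (u + v) = S u + S v + B u v"
  using extension by (auto simp: formal_extension_def)

sublocale twist: module_hom series_scale series_scale "fps_map \<alpha>"
  using vector_space_axioms twist by (rule fps_map_extends_scalars)

lemma twist_const: "fps_map \<alpha> (fps_const x) = fps_const (\<alpha> x)"
  using vector_space_axioms twist by (rule fps_map_extends_scalars)

text \<open>
  Bilinearity over power series already fixes each coefficient of \<open>B u (fps_const z)\<close>, because
  terms of high order in \<open>u\<close> contribute only to coefficients of high order.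
\<close>
lemma nth_B_const: "B u (fps_const z) $ m = (\<Sum>i\<le>m. c i (u $ (m - i)) z)"
proof (induction m arbitrary: u)
  case 0
  show ?case by (subst B_split) (simp add: nth_X_scale B_const)
next
  case (Suc m)
  show ?case
    by (subst B_split) (simp add: nth_X_scale B_const Suc.IH Suc_diff_le add.commute)
qed

lemma nth_J_const:
  "J (fps_const x) (fps_const y) (fps_const z) $ m = jacobi_coeff \<alpha> c m x y z"
  by (simp add: jacobiator_def jacobi_coeff_def twist_const nth_B_const B_const sum.distrib)

lemma nth_D_const:
  "x \<in> g1 \<Longrightarrow> D (fps_const x) (fps_const y) $ m = squaring_coeff \<alpha> c p m x y"
  by (simp add: squaring_defect_def squaring_coeff_def twist_const nth_B_const B_const S_const
      sum.distrib)

lemma J_cyclic: "J u v w = J v w u"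
  by (simp add: jacobiator_def ac_simps)

lemma J_add: "J (u + u') v w = J u v w + J u' v w"
  by (simp add: jacobiator_def B_simps twist.add ac_simps)

lemma J_scale: "J (a *t u) v w = a *t J u v w"
  by (simp add: jacobiator_def B_simps twist.scale series.scale_right_distrib)

lemma D_add_right: "D u (v + w) = D u v + D u w"
  by (simp add: squaring_defect_def B_simps twist.add ac_simps)

lemma D_scale_right: "D u (a *t v) = a *t D u v"
  by (simp add: squaring_defect_def B_simps twist.scale series.scale_right_distrib)

lemma D_scale_left: "u \<in> series_in g1 \<Longrightarrow> D (a *t u) v = a\<^sup>2 *t D u v"
  by (simp add: squaring_defect_def B_simps twist.scale S_scale series.scale_right_distrib
      power2_eq_square)

text \<open>
  The squaring defect is quadratic in its odd argument, with the Jacobiator as polar form.  Hence the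
  Jacobiator with two odd arguments is controlled by the squaring axiom, and conversely the defect
  is determined by its values on generators once the Jacobiator vanishes.
\<close>
lemma D_add_left:
  assumes "u \<in> series_in g1" "v \<in> series_in g1"
  shows "D (u + v) w = D u w + D v w + J u v w"
proof -
  have "B w u = B u w" by (rule symmetric)
  then show ?thesis
    using assms by (simp add: squaring_defect_def jacobiator_def B_simps twist.add S_add ac_simps)
qed

text \<open>
  Linearity is used in the first argument only; the cyclic symmetry moves the other arguments
  there one after the other.
\<close>
lemma J_vanishes:
  assumes "\<And>m x y z. m \<le> n \<Longrightarrow> jacobi_coeff \<alpha> c m x y z = 0"
  shows "vanishes n (J u v w)"
proof -
  have 0: "vanishes n (J (fps_const x) (fps_const y) (fps_const z))" for x y z
    using assms by (simp add: vanishes_def nth_J_const)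
  have step: "vanishes n (J u v w)" if "\<And>x. vanishes n (J (fps_const x) v w)" for u v w
    using J_add J_scale that by (rule vanishes_of_const[where F = "\<lambda>u. J u v w"])
  have 1: "vanishes n (J u (fps_const y) (fps_const z))" for u y z
    using 0 by (rule step)
  have 2: "vanishes n (J v (fps_const z) u)" for u v z
    by (rule step) (use 1 J_cyclic in metis)
  show ?thesis
    by (rule step) (use 2 J_cyclic in metis)
qed

lemma D_vanishes:
  assumes J: "\<And>m x y z. m \<le> n \<Longrightarrow> jacobi_coeff \<alpha> c m x y z = 0"
    and D: "\<And>m x y. m \<le> n \<Longrightarrow> x \<in> g1 \<Longrightarrow> squaring_coeff \<alpha> c p m x y = 0"
    and g1: "0 \<in> g1" and u: "u \<in> series_in g1"
  shows "vanishes n (D u v)"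
  using u
proof (induction rule: series_induct[where N = "Suc n"])
  case (const k x)
  have x: "fps_const x \<in> series_in g1" using const g1 by (auto simp: series_in_def)
  have "vanishes n (D (fps_const x) v)"
    using D_add_right D_scale_right
    by (rule vanishes_of_const) (use const D in \<open>simp add: vanishes_def nth_D_const\<close>)
  then show ?case
    by (simp add: D_scale_left[OF x] vanishes_X_power flip: power_mult)
next
  case (add u v')
  then show ?case by (simp add: D_add_left vanishes_add J_vanishes[OF J])
next
  case (high w)
  then show ?case by (simp add: D_scale_left vanishes_high del: power_Suc flip: power_mult)
qed (rule g1)

text \<open>
  For arbitrary arguments, decompose into homogeneous parts: two of the three have the same parity,
  and a cyclic shift brings them to the front.
\<close>
lemma coeffs_vanish:
  assumes "hom_lie_superalgebra_upto series_scale (eq_mod_t n) (series_in g0) (series_in g1)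
      B S (fps_map \<alpha>)" and "m \<le> n"
  shows "jacobi_coeff \<alpha> c m x y z = 0"
    and "x \<in> g1 \<Longrightarrow> squaring_coeff \<alpha> c p m x y = 0"
proof -
  interpret H: hom_lie_superalgebra_upto series_scale "eq_mod_t n" "series_in g0" "series_in g1"
      B S "fps_map \<alpha>" by fact
  have D: "vanishes n (D u v)" if "u \<in> series_in g1" for u v
    using H.squaring_jacobi[OF that, of v] symmetric[of "fps_map \<alpha> u"]
    by (simp add: eq_mod_t_iff_vanishes squaring_defect_def)
  have odd: "vanishes n (J u v w)" if "u \<in> series_in g1" "v \<in> series_in g1" for u v w
  proof -
    have "J u v w = D (u + v) w + (D u w + D v w)"
      by (simp add: D_add_left that char_2_simps)
    then show ?thesis
      using that by (simp add: vanishes_add D series.subspace_add[OF H.superspace(2)])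
  qed
  have even: "vanishes n (J u v w)" if u: "u \<in> series_in g0" and v: "v \<in> series_in g0" for u v w
  proof -
    obtain w0 w1 where w: "w = w0 + w1" "w0 \<in> series_in g0" "w1 \<in> series_in g1"
      using H.superspace(4) by blast
    have "vanishes n (J w0 u v)"
      using H.hom_jacobi[OF w(2) u v] symmetric
      by (simp add: eq_mod_t_iff_vanishes jacobiator_def ac_simps)
    moreover have "vanishes n (J w1 u v)"
      using H.hom_module[OF u v w(3)] symmetric
      by (simp add: eq_mod_t_iff_vanishes jacobiator_def ac_simps)
    ultimately have "vanishes n (J w u v)" by (simp add: w(1) J_add vanishes_add)
    then show ?thesis by (simp add: J_cyclic[of w])
  qed
  have all: "vanishes n (J u v w)" for u v w
  proof -
    obtain u0 u1 where u: "u = u0 + u1" "u0 \<in> series_in g0" "u1 \<in> series_in g1"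
      using H.superspace(4) by blast
    obtain v0 v1 where v: "v = v0 + v1" "v0 \<in> series_in g0" "v1 \<in> series_in g1"
      using H.superspace(4) by blast
    obtain w0 w1 where w: "w = w0 + w1" "w0 \<in> series_in g0" "w1 \<in> series_in g1"
      using H.superspace(4) by blast
    have add2: "J u (v + v') w = J u v w + J u v' w" for u v v' w
      by (metis J_add J_cyclic)
    have add3: "J u v (w + w') = J u v w + J u v w'" for u v w w'
      by (metis J_add J_cyclic)
    have "vanishes n (J u0 v1 w)"
      unfolding w add3 using odd[OF v(3) w(3), of u0] even[OF w(2) u(2), of v1]
      by (intro vanishes_add) (metis J_cyclic)+
    moreover have "vanishes n (J u1 v0 w)"
      unfolding w add3 using even[OF v(2) w(2), of u1] odd[OF w(3) u(3), of v0]
      by (intro vanishes_add) (metis J_cyclic)+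
    ultimately show ?thesis
      unfolding u v J_add add2 using even[OF u(2) v(2)] odd[OF u(3) v(3)]
      by (intro vanishes_add) auto
  qed
  show "jacobi_coeff \<alpha> c m x y z = 0"
    using all[of "fps_const x" "fps_const y" "fps_const z"] assms(2)
    by (simp add: vanishes_def nth_J_const)
  assume "x \<in> g1"
  then have "fps_const x \<in> series_in g1"
    using series.subspace_0[OF H.superspace(2)] by (auto simp: series_in_def)
  from D[OF this, of "fps_const y"] \<open>x \<in> g1\<close> assms(2)
  show "squaring_coeff \<alpha> c p m x y = 0"
    by (simp add: vanishes_def nth_D_const)
qed

end

section \<open>Extension of a single cochain to power series\<close>

text \<open>
  The extension of \<open>c\<close> that is bilinear over power series.
\<close>
definition conv :: "('g::ab_group_add \<Rightarrow> 'g \<Rightarrow> 'g) \<Rightarrow> 'g fps \<Rightarrow> 'g fps \<Rightarrow> 'g fps" where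
  "conv c u v = Abs_fps (\<lambda>m. \<Sum>j\<le>m. c (u $ j) (v $ (m - j)))"

context
  fixes c :: "'g::ab_group_add \<Rightarrow> 'g \<Rightarrow> 'g" and p :: "'g \<Rightarrow> 'g"
begin

text \<open>
  The quadratic refinement of \<open>conv c\<close> that extends \<open>p\<close>.  With \<open>u = u\<^sub>0 + t u'\<close> the rule
  \<open>p (u\<^sub>0 + t u') = p u\<^sub>0 + t\<^sup>2 p u' + t c u\<^sub>0 u'\<close> gives the coefficients by recursion; this avoids
  an explicit double sum over unordered pairs of indices.
\<close>
fun sqconv_nth :: "nat \<Rightarrow> 'g fps \<Rightarrow> 'g" where
  "sqconv_nth 0 u = p (u $ 0)"
| "sqconv_nth (Suc 0) u = c (u $ 0) (u $ 1)"
| "sqconv_nth (Suc (Suc m)) u = c (u $ 0) (u $ Suc (Suc m)) + sqconv_nth m (fps_shift 1 u)"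

definition sqconv :: "'g fps \<Rightarrow> 'g fps" where
  "sqconv u = Abs_fps (\<lambda>m. sqconv_nth m u)"

end

lemma conv_nth_0: "conv c u v $ 0 = c (u $ 0) (v $ 0)"
  by (simp add: conv_def)

lemma conv_nth_Suc: "conv c u v $ Suc m = c (u $ 0) (v $ Suc m) + conv c (fps_shift 1 u) v $ m"
  by (simp add: conv_def sum.atMost_Suc_shift del: sum.atMost_Suc)

lemma conv_commute:
  assumes "\<And>x y. c x y = c y x"
  shows "conv c u v = conv c v u"
proof (rule fps_ext)
  fix m
  have "(\<Sum>j\<le>m. c (u $ j) (v $ (m - j))) = (\<Sum>j\<le>m. c (v $ j) (u $ (m - j)))"
    by (rule sum.reindex_bij_witness[of _ "\<lambda>j. m - j" "\<lambda>j. m - j"]) (auto simp: assms)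
  then show "conv c u v $ m = conv c v u $ m" by (simp add: conv_def)
qed

lemma conv_nth_Suc_Suc:
  assumes "\<And>x y. c x y = c y x"
  shows "conv c u v $ Suc (Suc m) =
    c (u $ 0) (v $ Suc (Suc m)) + c (v $ 0) (u $ Suc (Suc m)) +
    conv c (fps_shift 1 u) (fps_shift 1 v) $ m"
  using conv_commute[of c, OF assms] by (simp add: conv_nth_Suc add.assoc)

lemma in_series_nth: "u \<in> series_in W \<Longrightarrow> u $ m \<in> W"
  by (simp add: series_in_def)

lemma fps_map_nth: "fps_map f u $ m = f (u $ m)"
  by (simp add: fps_map_def)

lemma in_series_shift: "u \<in> series_in W \<Longrightarrow> fps_shift k u \<in> series_in W"
  by (simp add: series_in_def)

locale twisted_superspace = char_2_space scale
  for scale :: "'k::field \<Rightarrow> 'g::ab_group_add \<Rightarrow> 'g" (infixr \<open>*s\<close> 74) +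
  fixes g0 g1 :: "'g set" and \<alpha> :: "'g \<Rightarrow> 'g"
  assumes parts: "subspace g0" "subspace g1" "g0 \<inter> g1 = {0}"
      "\<And>z. \<exists>x\<in>g0. \<exists>y\<in>g1. z = x + y"
    and twist: "module_hom scale scale \<alpha>"
    and twist_even: "\<And>x. x \<in> g0 \<Longrightarrow> \<alpha> x \<in> g0" "\<And>x. x \<in> g1 \<Longrightarrow> \<alpha> x \<in> g1"
begin

sublocale twist: module_hom scale scale \<alpha>
  by (rule twist)

lemma in_series_scale: "u \<in> series_in g1 \<Longrightarrow> a *t u \<in> series_in g1"
  using series.subspace_scale subspace_series_in[OF vector_space_axioms parts(2)] by blast

abbreviation cochains where "cochains \<equiv> XC2_even scale g0 g1 \<alpha>"

context
  fixes c p assumes cp: "(c, p) \<in> cochains"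
begin

lemma cochain:
  shows "bilinear_map scale c" and "c x x = 0" and "x \<in> g1 \<Longrightarrow> p (a *s x) = a\<^sup>2 *s p x"
    and "\<alpha> (c x y) = c (\<alpha> x) (\<alpha> y)" and "x \<in> g1 \<Longrightarrow> \<alpha> (p x) = p (\<alpha> x)"
    and "even_bilinear g0 g1 c" and "x \<in> g1 \<Longrightarrow> p x \<in> g0"
  using cp by (auto simp: XC2_even_def XC2_def)

lemmas c_simps = bilinear_mapD[OF cochain(1)]

lemma cochain_commute: "c x y = c y x"
proof -
  have "c (x + y) (x + y) = c x x + c x y + (c y x + c y y)"
    by (simp only: c_simps ac_simps)
  then show ?thesis by (metis cochain(2) eq_iff_add_eq_0 add_0_left add_0_right)
qed

lemma cochain_polar: "x \<in> g1 \<Longrightarrow> y \<in> g1 \<Longrightarrow> p (x + y) = p x + p y + c x y"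
proof -
  assume "x \<in> g1" "y \<in> g1"
  then have "c x y = p (x + y) + p x + p y"
    using cp by (auto simp: XC2_even_def XC2_def)
  then show "p (x + y) = p x + p y + c x y" by (simp add: char_2_simps)
qed

lemma p_0: "p 0 = 0"
  using cochain(3)[of 0 0] subspace_0[OF parts(2)] by simp

lemma conv_add: "conv c (u + u') v = conv c u v + conv c u' v"
  by (simp add: conv_def fps_eq_iff c_simps sum.distrib)

lemma conv_const_scale: "conv c (fps_const a *t u) v = fps_const a *t conv c u v"
  by (simp add: conv_def fps_eq_iff nth_const_scale c_simps scale_sum_right)

lemma conv_X_scale: "conv c (fps_X *t u) v = fps_X *t conv c u v"
proof (rule fps_ext)
  fix m
  have "fps_shift 1 (fps_X *t u) = u" by (simp add: fps_eq_iff nth_X_scale)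
  then show "conv c (fps_X *t u) v $ m = (fps_X *t conv c u v) $ m"
    by (cases m) (simp_all add: conv_nth_0 conv_nth_Suc nth_X_scale c_simps)
qed

lemma scale_split: "a *t u = fps_const (a $ 0) *t u + fps_X *t fps_shift 1 a *t u"
  by (subst scalar_split) (simp only: series.scale_left_distrib series.scale_scale)

text \<open>
  Scalars that are constants or \<open>t\<close> can be moved out at once; for a general scalar
  \<open>a = a\<^sub>0 + t a'\<close>, the coefficient of \<open>t^m\<close> reduces to that of \<open>t^(m-1)\<close> for \<open>a'\<close>.
\<close>
lemma conv_scale: "conv c (a *t u) v = a *t conv c u v"
proof (rule fps_ext)
  fix m show "conv c (a *t u) v $ m = (a *t conv c u v) $ m"
    by (induction m arbitrary: a; subst (1 2) scale_split)
      (simp_all add: conv_add conv_const_scale conv_X_scale nth_X_scale del: series.scale_scale)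
qed

lemma conv_bilinear: "bilinear_map series_scale (conv c)"
  using conv_commute[of c, OF cochain_commute]
  by (intro bilinear_mapI series.module_axioms) (metis conv_add conv_scale)+

text \<open>
  The terms of index \<open>j\<close> and \<open>m - j\<close> cancel by symmetry, and a middle term vanishes because \<open>c\<close>
  is alternating.
\<close>
lemma conv_alternating: "conv c u u = 0"
proof (rule fps_ext)
  fix m show "conv c u u $ m = 0 $ m"
  proof (induction m arbitrary: u rule: induct_nat_012[case_names 0 1 2])
    case (2 m)
    then show ?case by (simp add: conv_nth_Suc_Suc[of c, OF cochain_commute] add_self)
  next
    case 1
    then show ?case
      using cochain_commute[of "u $ 1" "u $ 0"]
      by (simp add: conv_nth_Suc conv_nth_0 add_self)
  qed (simp add: conv_nth_0 cochain(2))
qed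

lemma conv_const: "conv c (fps_const x) (fps_const y) = fps_const (c x y)"
proof (rule fps_ext)
  fix m show "conv c (fps_const x) (fps_const y) $ m = fps_const (c x y) $ m"
    by (cases m) (simp_all add: conv_nth_0 conv_nth_Suc fps_shift_fps_const c_simps conv_def)
qed

lemma conv_twist: "fps_map \<alpha> (conv c u v) = conv c (fps_map \<alpha> u) (fps_map \<alpha> v)"
  by (simp add: fps_map_def conv_def fps_eq_iff twist.sum cochain(4))

lemma conv_even: "even_bilinear (series_in g0) (series_in g1) (conv c)"
  using cochain(6) unfolding even_bilinear_def series_in_def conv_def
  by (auto intro!: subspace_sum[OF parts(1)] subspace_sum[OF parts(2)])

lemma sqconv_const:
  "x \<in> g1 \<Longrightarrow> sqconv c p (fps_const x) = fps_const (p x)"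
proof (rule fps_ext)
  have 0: "sqconv_nth c p m 0 = 0" for m
    by (induction m rule: induct_nat_012) (simp_all add: c_simps p_0)
  fix m show "sqconv c p (fps_const x) $ m = fps_const (p x) $ m"
    by (cases "(m, fps_const x)" rule: sqconv_nth.cases)
      (auto simp: sqconv_def fps_shift_fps_const c_simps 0)
qed

lemma sqconv_add:
  assumes "u \<in> series_in g1" "v \<in> series_in g1"
  shows "sqconv c p (u + v) = sqconv c p u + sqconv c p v + conv c u v"
proof (rule fps_ext)
  have "sqconv_nth c p m (u + v) = sqconv_nth c p m u + sqconv_nth c p m v + conv c u v $ m" for m
    using assms
  proof (induction m arbitrary: u v rule: induct_nat_012[case_names 0 1 2])
    case 0
    then show ?case by (simp add: cochain_polar series_in_def conv_nth_0)
  next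
    case 1
    then show ?case
      using cochain_commute[of "v $ 0" "u $ 1"]
      by (simp add: conv_nth_0 conv_nth_Suc c_simps ac_simps)
  next
    case (2 m)
    then show ?case
      by (simp add: conv_nth_Suc_Suc[of c, OF cochain_commute] c_simps fps_shift_add in_series_shift
          ac_simps)
  qed
  then show "sqconv c p (u + v) $ m = (sqconv c p u + sqconv c p v + conv c u v) $ m" for m
    by (simp add: sqconv_def)
qed

lemma sqconv_const_scale:
  assumes "u \<in> series_in g1"
  shows "sqconv c p (fps_const a *t u) = fps_const (a\<^sup>2) *t sqconv c p u"
proof (rule fps_ext)
  have sh: "fps_shift 1 (fps_const a *t u) = fps_const a *t fps_shift 1 u" for u
    by (simp add: fps_eq_iff nth_const_scale)
  have "sqconv_nth c p m (fps_const a *t u) = a\<^sup>2 *s sqconv_nth c p m u" for m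
    using assms
  proof (induction m arbitrary: u rule: induct_nat_012[case_names 0 1 2])
    case 0
    then show ?case by (simp add: cochain(3) series_in_def nth_const_scale)
  next
    case 1
    then show ?case by (simp add: c_simps nth_const_scale power2_eq_square)
  next
    case (2 m)
    then show ?case
      by (simp add: c_simps nth_const_scale power2_eq_square sh[simplified] in_series_shift
          scale_right_distrib)
  qed
  then show "sqconv c p (fps_const a *t u) $ m = (fps_const (a\<^sup>2) *t sqconv c p u) $ m" for m
    by (simp add: sqconv_def nth_const_scale)
qed

lemma sqconv_X_scale: "sqconv c p (fps_X *t u) = fps_X\<^sup>2 *t sqconv c p u"
proof (rule fps_ext)
  fix m
  have "fps_shift 1 (fps_X *t u) = u" by (simp add: fps_eq_iff nth_X_scale)
  then show "sqconv c p (fps_X *t u) $ m = (fps_X\<^sup>2 *t sqconv c p u) $ m"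
    by (cases "(m, u)" rule: sqconv_nth.cases)
      (auto simp: sqconv_def nth_X_scale nth_X_power_scale c_simps p_0)
qed

text \<open>
  As for \<open>conv_scale\<close>, but squared: in characteristic 2, \<open>a\<^sup>2 = a\<^sub>0\<^sup>2 + t\<^sup>2 a'\<^sup>2\<close>, and on the other
  side the mixed term \<open>t a\<^sub>0 a' c(u, u)\<close> is zero since the convolution is alternating.
\<close>
lemma sqconv_scale:
  assumes u: "u \<in> series_in g1"
  shows "sqconv c p (a *t u) = a\<^sup>2 *t sqconv c p u"
proof (rule fps_ext)
  have square: "a\<^sup>2 = fps_const ((a $ 0)\<^sup>2) + fps_X\<^sup>2 * (fps_shift 1 a)\<^sup>2" for a :: "'k fps"
  proof -
    have "(2 :: 'k fps) = of_nat CHAR('k fps)" by (simp add: char_2)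
    then have "(2 :: 'k fps) = 0" by (simp only: of_nat_CHAR)
    then show ?thesis
      by (subst scalar_split) (simp add: power2_sum power_mult_distrib fps_const_power)
  qed
  have split: "sqconv c p (a *t u) =
    fps_const ((a $ 0)\<^sup>2) *t sqconv c p u + fps_X\<^sup>2 *t sqconv c p (fps_shift 1 a *t u)" for a
  proof -
    have "conv c (b *t u) (fps_X *t b' *t u) = 0" for b b'
      using bilinear_mapD[OF conv_bilinear] by (simp add: conv_alternating)
    then show ?thesis
      using u by (subst scale_split)
        (simp add: sqconv_add in_series_scale sqconv_const_scale sqconv_X_scale del: series.scale_scale)
  qed
  fix m show "sqconv c p (a *t u) $ m = (a\<^sup>2 *t sqconv c p u) $ m"
  proof (induction m arbitrary: a rule: less_induct)
    case (less m)
    have "a\<^sup>2 *t sqconv c p u = fps_const ((a $ 0)\<^sup>2) *t sqconv c p u +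
        fps_X\<^sup>2 *t (fps_shift 1 a)\<^sup>2 *t sqconv c p u"
      by (subst square) (simp only: series.scale_left_distrib series.scale_scale)
    then show ?case
      using less[of "m - 2" "fps_shift 1 a"] by (simp add: split[of a] nth_X_power_scale del: series.scale_scale)
  qed
qed

lemma sqconv_twist:
  assumes "u \<in> series_in g1"
  shows "fps_map \<alpha> (sqconv c p u) = sqconv c p (fps_map \<alpha> u)"
proof (rule fps_ext)
  have sh: "fps_shift 1 (fps_map \<alpha> u) = fps_map \<alpha> (fps_shift 1 u)" for u
    by (simp add: fps_eq_iff fps_map_nth)
  have "\<alpha> (sqconv_nth c p m u) = sqconv_nth c p m (fps_map \<alpha> u)" for m
    using assms
    by (induction m arbitrary: u rule: induct_nat_012)
      (simp_all add: sh[simplified] in_series_shift cochain(4,5) twist.add in_series_nth fps_map_nth)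
  then show "fps_map \<alpha> (sqconv c p u) $ m = sqconv c p (fps_map \<alpha> u) $ m" for m
    by (simp add: sqconv_def fps_map_def)
qed

lemma sqconv_even:
  assumes "u \<in> series_in g1"
  shows "sqconv c p u \<in> series_in g0"
proof -
  have cc: "x \<in> g1 \<Longrightarrow> y \<in> g1 \<Longrightarrow> c x y \<in> g0" for x y
    using cochain(6) by (simp add: even_bilinear_def)
  have "sqconv_nth c p m u \<in> g0" for m
    using assms
  proof (induction m arbitrary: u rule: induct_nat_012[case_names 0 1 2])
    case (2 m)
    then have "sqconv_nth c p m (fps_shift 1 u) \<in> g0" by (simp add: in_series_shift)
    then show ?case using 2 cc by (auto intro!: subspace_add[OF parts(1)] simp: series_in_def)
  qed (auto simp: series_in_def cc cochain(7))
  then show ?thesis by (simp add: sqconv_def series_in_def)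
qed

end

section \<open>Deformations of finite order and vanishing coefficients\<close>

definition series_bracket ::
  "nat \<Rightarrow> (nat \<Rightarrow> 'g \<Rightarrow> 'g \<Rightarrow> 'g) \<Rightarrow> 'g fps \<Rightarrow> 'g fps \<Rightarrow> 'g fps" where
  "series_bracket n c u v = (\<Sum>i\<le>n. fps_X ^ i *t conv (c i) u v)"

definition series_squaring ::
  "nat \<Rightarrow> (nat \<Rightarrow> 'g \<Rightarrow> 'g \<Rightarrow> 'g) \<Rightarrow> (nat \<Rightarrow> 'g \<Rightarrow> 'g) \<Rightarrow> 'g fps \<Rightarrow> 'g fps" where
  "series_squaring n c p u = (\<Sum>i\<le>n. fps_X ^ i *t sqconv (c i) (p i) u)"

lemma nth_sum_X_power_const:
  "(\<Sum>i\<le>n. fps_X ^ i *t fps_const (x i)) = Abs_fps (\<lambda>i. if i \<le> n then x i else 0)"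
proof (rule fps_ext)
  fix m
  have "(\<Sum>i\<le>n. fps_X ^ i *t fps_const (x i)) $ m = (\<Sum>i\<in>{..n}. if m = i then x i else 0)"
    unfolding fps_sum_nth by (rule sum.cong) (auto simp: nth_X_power_scale)
  then show "(\<Sum>i\<le>n. fps_X ^ i *t fps_const (x i)) $ m =
      Abs_fps (\<lambda>i. if i \<le> n then x i else 0) $ m"
    by simp
qed

context
  fixes n :: nat and c p assumes cp: "\<And>i. i \<le> n \<Longrightarrow> (c i, p i) \<in> cochains"
begin

lemma series_bracket_bilinear: "bilinear_map series_scale (series_bracket n c)"
proof (rule bilinear_mapI)
  note b = bilinear_mapD[OF conv_bilinear[OF cp]]
  have comm: "a *t fps_X ^ i *t u = fps_X ^ i *t a *t u" for a i and u :: "'g fps"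
    by (simp add: mult.commute)
  show "series_bracket n c (u + u') v = series_bracket n c u v + series_bracket n c u' v" for u u' v
    by (simp add: series_bracket_def b series.scale_right_distrib sum.distrib)
  show "series_bracket n c u (v + v') = series_bracket n c u v + series_bracket n c u v'" for u v v'
    by (simp add: series_bracket_def b series.scale_right_distrib sum.distrib)
  show "series_bracket n c (a *t u) v = a *t series_bracket n c u v" for a u v
    unfolding series_bracket_def series.scale_sum_right comm by (simp add: b)
  show "series_bracket n c u (a *t v) = a *t series_bracket n c u v" for a u v
    unfolding series_bracket_def series.scale_sum_right comm by (simp add: b)
qed (rule series.module_axioms)

lemma series_bracket_commute: "series_bracket n c u v = series_bracket n c v u"
  unfolding series_bracket_def
  by (intro sum.cong refl arg_cong[where f = "series_scale _"] conv_commute)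
    (simp add: cochain_commute[OF cp])

lemma series_bracket_twist:
  "fps_map \<alpha> (series_bracket n c u v) = series_bracket n c (fps_map \<alpha> u) (fps_map \<alpha> v)"
proof -
  interpret f: module_hom series_scale series_scale "fps_map \<alpha>"
    using vector_space_axioms twist by (rule fps_map_extends_scalars)
  show ?thesis by (simp add: series_bracket_def f.sum f.scale conv_twist[OF cp])
qed

lemma series_squaring_twist:
  assumes "u \<in> series_in g1"
  shows "fps_map \<alpha> (series_squaring n c p u) = series_squaring n c p (fps_map \<alpha> u)"
proof -
  interpret f: module_hom series_scale series_scale "fps_map \<alpha>"
    using vector_space_axioms twist by (rule fps_map_extends_scalars)
  show ?thesis by (simp add: series_squaring_def f.sum f.scale sqconv_twist[OF cp assms])
qed

text \<open>
  All conditions hold for each cochain separately and are stable under combining them with the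
  coefficients \<open>t^i\<close>.
\<close>
lemma formal_extension_exists:
  "formal_extension scale g1 (\<lambda>i x y. if i \<le> n then c i x y else 0)
     (\<lambda>i x. if i \<le> n then p i x else 0) (series_bracket n c) (series_squaring n c p)"
  unfolding formal_extension_def
proof (intro conjI ballI allI)
  show "bilinear_map series_scale (series_bracket n c)" by (rule series_bracket_bilinear)
  show "series_bracket n c (fps_const x) (fps_const y) =
      Abs_fps (\<lambda>i. if i \<le> n then c i x y else 0)" for x y
    by (simp add: series_bracket_def conv_const[OF cp] nth_sum_X_power_const)
  show "series_squaring n c p (fps_const x) = Abs_fps (\<lambda>i. if i \<le> n then p i x else 0)"
    if "x \<in> g1" for x
    using that by (simp add: series_squaring_def sqconv_const[OF cp] nth_sum_X_power_const)
  show "series_squaring n c p (a *t u) = a\<^sup>2 *t series_squaring n c p u"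
    if "u \<in> series_in g1" for a u
    using that by (simp add: series_squaring_def sqconv_scale[OF cp] series.scale_sum_right ac_simps)
  show "series_squaring n c p (u + v) =
      series_squaring n c p u + series_squaring n c p v + series_bracket n c u v"
    if "u \<in> series_in g1" "v \<in> series_in g1" for u v
    using that by (simp add: series_squaring_def series_bracket_def sqconv_add[OF cp]
        series.scale_right_distrib sum.distrib)
qed

text \<open>
  Only the Jacobi identity, the module axiom and the squaring axiom hold merely modulo
  \<open>t^(n+1)\<close>; the other conditions hold exactly for the extended cochains.
\<close>
lemma hom_lie_superalgebra_mod:
  assumes jacobi: "\<And>m x y z. m \<le> n \<Longrightarrow> jacobi_coeff \<alpha> c m x y z = 0"
    and squaring: "\<And>m x y. m \<le> n \<Longrightarrow> x \<in> g1 \<Longrightarrow> squaring_coeff \<alpha> c p m x y = 0"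
  shows "hom_lie_superalgebra_upto series_scale (eq_mod_t n) (series_in g0) (series_in g1)
    (series_bracket n c) (series_squaring n c p) (fps_map \<alpha>)"
proof -
  let ?c = "\<lambda>i x y. if i \<le> n then c i x y else 0" and ?p = "\<lambda>i x. if i \<le> n then p i x else 0"
  let ?B = "series_bracket n c" and ?S = "series_squaring n c p"
  have trunc: "jacobi_coeff \<alpha> ?c m = jacobi_coeff \<alpha> c m"
    "squaring_coeff \<alpha> ?c ?p m = squaring_coeff \<alpha> c p m" if "m \<le> n" for m
    using that by (intro jacobi_coeff_cong squaring_coeff_cong ext; simp)+
  interpret formal_superalgebra scale g1 ?c ?p ?B ?S \<alpha>
    by unfold_locales
      (rule formal_extension_exists, rule series_bracket_commute)
  note sub = subspace_series_in[OF vector_space_axioms parts(1)]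
    subspace_series_in[OF vector_space_axioms parts(2)]
  have "vanishes n (J u v w)" for u v w
    by (rule J_vanishes) (simp add: trunc jacobi)
  then have J: "\<And>u v w k. k \<le> n \<Longrightarrow> J u v w $ k = 0" by (simp add: vanishes_def)
  have "vanishes n (D u v)" if "u \<in> series_in g1" for u v
    using _ _ subspace_0[OF parts(2)] that
    by (rule D_vanishes) (simp_all add: trunc jacobi squaring)
  then have D: "eq_mod_t n (?B (?S u) (fps_map \<alpha> v)) (?B (fps_map \<alpha> u) (?B u v))"
    if "u \<in> series_in g1" for u v
    using that series_bracket_commute[of "fps_map \<alpha> u"]
    by (simp add: eq_mod_t_iff_vanishes squaring_defect_def)
  have refl: "eq_mod_t n u u" for u :: "'g fps" by (simp add: eq_mod_t_def)
  have twisted: "eq_mod_t n (fps_map \<alpha> (?B u v)) (?B (fps_map \<alpha> u) (fps_map \<alpha> v))" for u v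
    using refl by (simp add: series_bracket_twist)
  show ?thesis
  proof
    show "CHAR('k fps) = 2" by (simp add: char_2)
    show "series.subspace (series_in g0)" "series.subspace (series_in g1)" by (rule sub)+
    show "series_in g0 \<inter> series_in g1 = {0}"
    proof -
      have "x \<in> g0 \<and> x \<in> g1 \<longleftrightarrow> x = 0" for x using parts(3) by blast
      then have "u \<in> series_in g0 \<and> u \<in> series_in g1 \<longleftrightarrow> u = 0" for u
        by (auto simp: series_in_def fps_eq_iff)
      then show ?thesis by blast
    qed
    show "\<exists>x\<in>series_in g0. \<exists>y\<in>series_in g1. z = x + y" for z
    proof -
      obtain f h where "\<And>m. f m \<in> g0" "\<And>m. h m \<in> g1" "\<And>m. z $ m = f m + h m"
      proof -
        have "\<forall>m. \<exists>x y. x \<in> g0 \<and> y \<in> g1 \<and> z $ m = x + y" using parts(4) by blast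
        then show ?thesis using that by metis
      qed
      then show ?thesis
        by (intro bexI[of _ "Abs_fps f"] bexI[of _ "Abs_fps h"])
          (auto simp: series_in_def fps_eq_iff)
    qed
    show "bilinear_map series_scale ?B" by (rule series_bracket_bilinear)
    show "?B u v = ?B v u" for u v by (rule series_bracket_commute)
    show "even_bilinear (series_in g0) (series_in g1) ?B"
      using conv_even[OF cp] unfolding even_bilinear_def series_bracket_def
      by (auto intro!: series.subspace_sum series.subspace_scale sub)
    show "?S u \<in> series_in g0" if "u \<in> series_in g1" for u
      using sqconv_even[OF cp that] unfolding series_squaring_def
      by (auto intro!: series.subspace_sum series.subspace_scale sub)
    show "?S (a *t u) = a\<^sup>2 *t ?S u" if "u \<in> series_in g1" for a u using that by (rule S_scale)
    show "fps_map \<alpha> u \<in> series_in g0" if "u \<in> series_in g0" for u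
      using that by (simp add: series_in_def fps_map_nth twist_even)
    show "fps_map \<alpha> u \<in> series_in g1" if "u \<in> series_in g1" for u
      using that by (simp add: series_in_def fps_map_nth twist_even)
    show "eq_mod_t n (?B u u) 0" for u
      using refl by (simp add: series_bracket_def conv_alternating[OF cp])
    show "eq_mod_t n (fps_map \<alpha> (?B u v)) (?B (fps_map \<alpha> u) (fps_map \<alpha> v))" for u v
      by (rule twisted)
    show "eq_mod_t n (?B (fps_map \<alpha> u) (fps_map \<alpha> v)) (fps_map \<alpha> (?B u v))" for u v
      using refl by (simp add: series_bracket_twist)
    show "eq_mod_t n (?B (fps_map \<alpha> u) (?B v w) + ?B (fps_map \<alpha> v) (?B w u) +
        ?B (fps_map \<alpha> w) (?B u v)) 0" for u v w
      using J[of _ u v w] series_bracket_commute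
      by (simp add: eq_mod_t_def jacobiator_def ac_simps)
    show "eq_mod_t n (?B (?B u v) (fps_map \<alpha> w))
        (?B (fps_map \<alpha> u) (?B v w) + ?B (fps_map \<alpha> v) (?B u w))" for u v w
      using J[of _ u v w] series_bracket_commute
      by (simp add: eq_mod_t_iff_vanishes vanishes_def jacobiator_def ac_simps)
    show "eq_mod_t n (?S (u + v) + ?S u + ?S v) (?B u v)"
      if "u \<in> series_in g1" "v \<in> series_in g1" for u v
      using refl that by (simp add: S_add char_2_simps)
    show "eq_mod_t n (?B (?S u) (fps_map \<alpha> v)) (?B (fps_map \<alpha> u) (?B u v))"
      if "u \<in> series_in g1" for u v using that by (rule D)
    show "eq_mod_t n (fps_map \<alpha> (?S u)) (?S (fps_map \<alpha> u))" if "u \<in> series_in g1" for u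
      using refl that by (simp add: series_squaring_twist)
  qed (rule twisted)
qed

end

lemma cochains_cong:
  assumes "\<And>x. x \<in> g1 \<Longrightarrow> p x = p' x"
  shows "(c, p) \<in> cochains \<longleftrightarrow> (c, p') \<in> cochains"
proof -
  note closed = subspace_scale[OF parts(2)] subspace_add[OF parts(2)]
  show ?thesis
    by (simp add: XC2_even_def XC2_def assms closed twist_even cong: ball_cong)
qed

text \<open>
  The undeformed structure is itself an even cochain, so index 0 can be treated like the others.
  The bracket is alternating on odd elements because \<open>[x, x] = s (2 x) + 2 s x = 0\<close>.
\<close>
lemma bracket_squaring_cochain:
  assumes "hom_lie_superalgebra scale g0 g1 br s \<alpha>"
  shows "(br, s) \<in> cochains"
proof -
  interpret hom_lie_superalgebra_upto scale "(=)" g0 g1 br s \<alpha> by fact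
  note b = bilinear_mapD[OF bracket_bilinear]
  have odd: "br x x = 0" if "x \<in> g1" for x
  proof -
    have "s (x + x) + s x + s x = s 0" by (simp add: char_2_simps)
    also have "s 0 = 0" using squaring_scale[of 0 0] subspace_0[OF parts(2)] by simp
    finally show ?thesis using squaring_polar[OF that that] by simp
  qed
  have "br z z = 0" for z
  proof -
    obtain x y where z: "z = x + y" "x \<in> g0" "y \<in> g1" using parts(4) by blast
    have "br z z = br x x + br y y + (br x y + br x y)"
      using bracket_symmetric[of y x] by (simp add: z(1) b ac_simps)
    then show ?thesis by (simp add: bracket_self z odd add_self)
  qed
  then show ?thesis
    by (simp add: XC2_even_def XC2_def bracket_bilinear bracket_even squaring_even squaring_scale
        twist_bracket twist_squaring squaring_polar)
qed

text \<open>
  The right-hand side speaks only of maps on the original space.  Enlarging \<open>n\<close> by one therefore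
  adds one pair of identities there, although the maps on power series for the two orders differ.
\<close>
lemma deformation_of_order_iff:
  assumes g: "hom_lie_superalgebra scale g0 g1 br s \<alpha>"
  shows "deformation_of_order n scale g0 g1 br s \<alpha> c p \<longleftrightarrow>
    c 0 = br \<and> (\<forall>x\<in>g1. p 0 x = s x) \<and> (\<forall>i\<in>{1..n}. (c i, p i) \<in> cochains) \<and>
    (\<forall>m\<le>n. (\<forall>x y z. jacobi_coeff \<alpha> c m x y z = 0) \<and>
      (\<forall>x\<in>g1. \<forall>y. squaring_coeff \<alpha> c p m x y = 0))"
    (is "?L \<longleftrightarrow> ?z \<and> ?o \<and> ?i \<and> ?coeffs")
proof -
  let ?c = "\<lambda>i x y. if i \<le> n then c i x y else 0" and ?p = "\<lambda>i x. if i \<le> n then p i x else 0"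
  have trunc: "jacobi_coeff \<alpha> ?c m = jacobi_coeff \<alpha> c m"
    "squaring_coeff \<alpha> ?c ?p m = squaring_coeff \<alpha> c p m" if "m \<le> n" for m
    using that by (intro jacobi_coeff_cong squaring_coeff_cong ext; simp)+
  have ?coeffs if ?L
  proof -
    from that obtain B S where ext: "formal_extension scale g1 ?c ?p B S"
      and hom: "hom_lie_superalgebra_upto series_scale (eq_mod_t n) (series_in g0) (series_in g1)
        B S (fps_map \<alpha>)"
      unfolding deformation_of_order_def by blast
    interpret formal_superalgebra scale g1 ?c ?p B S \<alpha>
      using hom_lie_superalgebra_upto.bracket_symmetric[OF hom] ext twist
      by unfold_locales
    show ?thesis using coeffs_vanish[OF hom] by (simp add: trunc)
  qed
  moreover have "?z \<and> ?o \<and> ?i" if ?L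
    using that unfolding deformation_of_order_def by blast
  moreover have ?L if data: "?z \<and> ?o \<and> ?i \<and> ?coeffs"
  proof -
    have "(br, s) \<in> cochains" using g by (rule bracket_squaring_cochain)
    then have "(c 0, p 0) \<in> cochains"
      using cochains_cong[of "p 0" s] data by simp
    then have cp: "\<And>i. i \<le> n \<Longrightarrow> (c i, p i) \<in> cochains"
      using data by (metis One_nat_def Suc_leI atLeastAtMost_iff not_gr_zero)
    have "formal_extension scale g1 ?c ?p (series_bracket n c) (series_squaring n c p)"
      using cp by (rule formal_extension_exists)
    moreover have "hom_lie_superalgebra_upto series_scale (eq_mod_t n)
        (series_in g0) (series_in g1) (series_bracket n c) (series_squaring n c p) (fps_map \<alpha>)"
      using cp by (rule hom_lie_superalgebra_mod) (use data in auto)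
    ultimately show ?thesis
      unfolding deformation_of_order_def using data by blast
  qed
  ultimately show ?thesis by blast
qed

end

section \<open>The obstruction\<close>

lemma hom_lie_superalgebra_imp_mod:
  assumes "hom_lie_superalgebra sc G0 G1 B S a"
  shows "hom_lie_superalgebra_upto sc (eq_mod_t n) G0 G1 B S a"
proof -
  interpret hom_lie_superalgebra_upto sc "(=)" G0 G1 B S a by fact
  interpret module_hom sc sc a by (rule twist_linear)
  have eqI: "eq_mod_t n u v" if "u = v" for u v using that by (simp add: eq_mod_t_def)
  show ?thesis
    by unfold_locales
      ((rule char_2 superspace bracket_bilinear bracket_symmetric bracket_even squaring_even
          squaring_scale twist_even | assumption
        | (rule eqI, rule bracket_self hom_jacobi twist_action hom_module
          squaring_polar squaring_jacobi twist_bracket twist_squaring))+)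
qed

lemma sum_endpoints:
  fixes f :: "nat \<Rightarrow> nat \<Rightarrow> 'a::ab_group_add"
  assumes "n \<ge> 1"
  shows "(\<Sum>i\<le>n. f i (n - i)) =
    (\<Sum>(i, j)\<in>{(i, j). i + j = n \<and> i < n \<and> j < n}. f i j) + (f 0 n + f n 0)"
proof -
  have "{..n} = insert 0 (insert n {0<..<n})" using assms by auto
  then have "(\<Sum>i\<le>n. f i (n - i)) = (\<Sum>i\<in>{0<..<n}. f i (n - i)) + (f 0 n + f n 0)"
    using assms by (simp add: ac_simps)
  moreover have "(\<Sum>i\<in>{0<..<n}. f i (n - i)) =
      (\<Sum>(i, j)\<in>{(i, j). i + j = n \<and> i < n \<and> j < n}. f i j)"
    by (rule sum.reindex_bij_witness[of _ fst "\<lambda>i. (i, n - i)"]) auto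
  ultimately show ?thesis by simp
qed

lemma obstruction_C_1: "obstruction_C \<alpha> c 1 x y z = 0"
  and obstruction_Q_1: "obstruction_Q \<alpha> c p 1 x y = 0"
proof -
  have "{(i, j). i + j = 1 \<and> i < 1 \<and> j < (1::nat)} = {}" by auto
  then show "obstruction_C \<alpha> c 1 x y z = 0" "obstruction_Q \<alpha> c p 1 x y = 0"
    unfolding obstruction_C_def obstruction_Q_def by (simp_all only: sum.empty add_0_left)
qed

text \<open>
  The end terms of the convolution are those in which \<open>c n\<close> meets the bracket, and they form the
  differential of \<open>c n\<close>; similarly for the squaring below.
\<close>
lemma jacobi_coeff_top:
  assumes "n \<ge> 1" and "c 0 = br" and "\<And>x y. br x y = br y x"
  shows "jacobi_coeff \<alpha> c n x y z = obstruction_C \<alpha> c n x y z + d2_c br \<alpha> (c n) x y z"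
proof -
  have "jacobi_coeff \<alpha> c n x y z = obstruction_C \<alpha> c n x y z +
    ((c 0 (c n x y) (\<alpha> z) + c 0 (c n y z) (\<alpha> x) + c 0 (c n z x) (\<alpha> y)) +
     (c n (c 0 x y) (\<alpha> z) + c n (c 0 y z) (\<alpha> x) + c n (c 0 z x) (\<alpha> y)))"
    unfolding jacobi_coeff_def obstruction_C_def using assms(1) by (subst sum_endpoints) auto
  also have "\<dots> = obstruction_C \<alpha> c n x y z + d2_c br \<alpha> (c n) x y z"
    using assms(3)[of "\<alpha> x"] assms(3)[of "\<alpha> y"] assms(3)[of "\<alpha> z"]
    by (simp add: assms(2) d2_c_def ac_simps)
  finally show ?thesis .
qed

lemma squaring_coeff_top:
  assumes "n \<ge> 1" and "c 0 = br" and "p 0 x = s x" and "\<And>x y. br x y = br y x"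
  shows "squaring_coeff \<alpha> c p n x y = obstruction_Q \<alpha> c p n x y + d2_p br s \<alpha> (c n) (p n) x y"
proof -
  have "squaring_coeff \<alpha> c p n x y = obstruction_Q \<alpha> c p n x y +
    ((c 0 (p n x) (\<alpha> y) + c 0 (c n x y) (\<alpha> x)) +
     (c n (p 0 x) (\<alpha> y) + c n (c 0 x y) (\<alpha> x)))"
    unfolding squaring_coeff_def obstruction_Q_def sum.distrib[symmetric] split_def
    using assms(1) by (subst sum_endpoints) (auto simp: split_def)
  also have "\<dots> = obstruction_Q \<alpha> c p n x y + d2_p br s \<alpha> (c n) (p n) x y"
    using assms(4)[of "\<alpha> x"] assms(4)[of "\<alpha> y"]
    by (simp add: assms(2,3) d2_p_def ac_simps)
  finally show ?thesis .
qed

lemma obstruction_fun_upd: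
  "obstruction_C \<alpha> (c(n := c\<^sub>n)) n = obstruction_C \<alpha> c n"
  "obstruction_Q \<alpha> (c(n := c\<^sub>n)) (p(n := p\<^sub>n)) n = obstruction_Q \<alpha> c p n"
  unfolding obstruction_C_def obstruction_Q_def fun_eq_iff
  by (auto intro!: sum.cong arg_cong2[where f = "(+)"])

text \<open>
  Passing from order \<open>n - 1\<close> to \<open>n\<close> adds only the conditions for the coefficient of \<open>t^n\<close>, since the
  lower coefficients do not involve \<open>c\<^sub>n\<close> and \<open>p\<^sub>n\<close>.
\<close>
lemma (in twisted_superspace) extends_iff:
  assumes g: "hom_lie_superalgebra scale g0 g1 br s \<alpha>" and n: "n > 1"
    and old: "deformation_of_order (n - 1) scale g0 g1 br s \<alpha> c p"
  shows "deformation_of_order n scale g0 g1 br s \<alpha> (c(n := c\<^sub>n)) (p(n := p\<^sub>n)) \<longleftrightarrow>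
    (c\<^sub>n, p\<^sub>n) \<in> cochains \<and>
    (\<forall>x y z. obstruction_C \<alpha> c n x y z = d2_c br \<alpha> c\<^sub>n x y z) \<and>
    (\<forall>x\<in>g1. \<forall>y. obstruction_Q \<alpha> c p n x y = d2_p br s \<alpha> c\<^sub>n p\<^sub>n x y)"
proof -
  let ?c = "c(n := c\<^sub>n)" and ?p = "p(n := p\<^sub>n)"
  note old = old[unfolded deformation_of_order_iff[OF g]]
  have sym: "br x y = br y x" for x y
    using g by (rule hom_lie_superalgebra_upto.bracket_symmetric)
  have "jacobi_coeff \<alpha> ?c n x y z = 0 \<longleftrightarrow> obstruction_C \<alpha> c n x y z = d2_c br \<alpha> c\<^sub>n x y z"
    for x y z
    using jacobi_coeff_top[of n ?c br \<alpha> x y z, OF _ _ sym] n old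
    by (simp add: obstruction_fun_upd eq_iff_add_eq_0[of "obstruction_C \<alpha> c n x y z"])
  moreover have
    "squaring_coeff \<alpha> ?c ?p n x y = 0 \<longleftrightarrow> obstruction_Q \<alpha> c p n x y = d2_p br s \<alpha> c\<^sub>n p\<^sub>n x y"
    if "x \<in> g1" for x y
    using squaring_coeff_top[of n ?c br ?p x s \<alpha> y, OF _ _ _ sym] n old that
    by (simp add: obstruction_fun_upd eq_iff_add_eq_0[of "obstruction_Q \<alpha> c p n x y"])
  moreover have "jacobi_coeff \<alpha> ?c m = jacobi_coeff \<alpha> c m" if "m \<le> n - 1" for m
    by (rule jacobi_coeff_cong) (use that n in auto)
  moreover have "squaring_coeff \<alpha> ?c ?p m = squaring_coeff \<alpha> c p m" if "m \<le> n - 1" for m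
    by (rule squaring_coeff_cong) (use that n in auto)
  moreover have "(\<forall>m\<le>n. Q m) \<longleftrightarrow> (\<forall>m\<le>n - 1. Q m) \<and> Q n" for Q :: "nat \<Rightarrow> bool"
    using n by (metis Suc_diff_1 le_Suc_eq less_imp_le less_trans zero_less_one)
  moreover have "(\<forall>i\<in>{1..n}. Q i) \<longleftrightarrow> (\<forall>i\<in>{1..n - 1}. Q i) \<and> Q n" for Q :: "nat \<Rightarrow> bool"
  proof -
    have "{1..n} = insert n {1..n - 1}" using n by auto
    then show ?thesis by auto
  qed
  ultimately show ?thesis
    unfolding deformation_of_order_iff[OF g] using old n by auto
qed

lemma twisted_superspace_of_hom_lie:
  assumes "CHAR('k::field) = 2" and "vector_space scale"
    and "hom_lie_superalgebra (scale :: 'k \<Rightarrow> 'g::ab_group_add \<Rightarrow> 'g) g0 g1 br s \<alpha>"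
  shows "twisted_superspace scale g0 g1 \<alpha>"
proof -
  interpret vector_space scale by fact
  interpret hom_lie_superalgebra_upto scale "(=)" g0 g1 br s \<alpha> by fact
  show ?thesis
    by (intro twisted_superspace.intro char_2_space.intro char_2_space_axioms.intro
        twisted_superspace_axioms.intro assms superspace twist_linear twist_even)
qed

theorem theorem6p8:
  fixes scale :: "'k::field \<Rightarrow> 'g::ab_group_add \<Rightarrow> 'g"
    and g0 g1 :: "'g set"
    and br :: "'g \<Rightarrow> 'g \<Rightarrow> 'g"
    and s \<alpha> :: "'g \<Rightarrow> 'g"
    and c :: "nat \<Rightarrow> 'g \<Rightarrow> 'g \<Rightarrow> 'g"
    and p :: "nat \<Rightarrow> 'g \<Rightarrow> 'g"
    and br\<^sub>t :: "'g fps \<Rightarrow> 'g fps \<Rightarrow> 'g fps"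
    and s\<^sub>t :: "'g fps \<Rightarrow> 'g fps"
  assumes "CHAR('k) = 2"
    and "finite_dimensional scale"
    and "hom_lie_superalgebra scale g0 g1 br s \<alpha>"
    and "deformation scale g0 g1 br s \<alpha> c p br\<^sub>t s\<^sub>t"
    and "(\<exists>x y. c 1 x y \<noteq> 0) \<or> (\<exists>x\<in>g1. p 1 x \<noteq> 0)"
  shows "(c 1, p 1) \<in> Z2 scale g1 br s \<alpha> \<and>
    (\<forall>n>1. \<forall>c' p'. deformation_of_order (n - 1) scale g0 g1 br s \<alpha> c' p' \<longrightarrow>
       ((\<exists>c\<^sub>n p\<^sub>n. deformation_of_order n scale g0 g1 br s \<alpha> (c'(n := c\<^sub>n)) (p'(n := p\<^sub>n))) \<longleftrightarrow>
        (\<exists>(c\<^sub>n, p\<^sub>n) \<in> XC2_even scale g0 g1 \<alpha>.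
           (\<forall>x y z. obstruction_C \<alpha> c' n x y z = d2_c br \<alpha> c\<^sub>n x y z) \<and>
           (\<forall>x\<in>g1. \<forall>y. obstruction_Q \<alpha> c' p' n x y = d2_p br s \<alpha> c\<^sub>n p\<^sub>n x y))))"
proof -
  obtain b where "finite_dimensional_vector_space scale b"
    using assms(2) unfolding finite_dimensional_def by blast
  then interpret V: vector_space scale by (rule finite_dimensional_vector_space.axioms(1))
  interpret twisted_superspace scale g0 g1 \<alpha>
    using assms(1) V.vector_space_axioms assms(3) by (rule twisted_superspace_of_hom_lie)
  have def: "c 0 = br" "\<And>x. x \<in> g1 \<Longrightarrow> p 0 x = s x" "(c 1, p 1) \<in> cochains"
    "formal_extension scale g1 c p br\<^sub>t s\<^sub>t"
    "hom_lie_superalgebra series_scale (series_in g0) (series_in g1) br\<^sub>t s\<^sub>t (fps_map \<alpha>)"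
    using assms(4) by (auto simp: deformation_def)
  have sym: "br x y = br y x" for x y
    using assms(3) by (rule hom_lie_superalgebra_upto.bracket_symmetric)
  interpret formal_superalgebra scale g1 c p br\<^sub>t s\<^sub>t \<alpha>
    using hom_lie_superalgebra_upto.bracket_symmetric[OF def(5)] def(4)
    by unfold_locales
  have "d2_c br \<alpha> (c 1) x y z = 0" for x y z
    using coeffs_vanish(1)[OF hom_lie_superalgebra_imp_mod[OF def(5)], of 1 1 x y z]
      jacobi_coeff_top[of 1 c br \<alpha> x y z, OF _ def(1) sym]
    by (simp add: obstruction_C_1 del: One_nat_def)
  moreover have "d2_p br s \<alpha> (c 1) (p 1) x y = 0" if "x \<in> g1" for x y
    using coeffs_vanish(2)[OF hom_lie_superalgebra_imp_mod[OF def(5)] _ that, of 1 1 y]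
      squaring_coeff_top[of 1 c br p x s \<alpha> y, OF _ def(1) def(2)[OF that] sym]
    by (simp add: obstruction_Q_1 del: One_nat_def)
  ultimately have "(c 1, p 1) \<in> Z2 scale g1 br s \<alpha>"
    using def(3) by (simp add: Z2_def XC2_even_def)
  then show ?thesis using extends_iff[OF assms(3)] by blast
qed

end
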